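(* Consider linear Markov games with feature map $\phi(s,a,b)\in\mathbb R^d$, and let $\epsilon>0$. Choose $\ell(f,\xi_h)=D_{\mathrm{He}}^2(\mathbb P_{f,h}(\cdot|\xi_h),\mathbb P_{f^*,h}(\cdot|\xi_h))$ with $\xi_h=(s_h,a_h,b_h)$. Then, when $T$ is sufficiently large, $$\text{linear MG}\ \subset\ \text{MG with low self-play and adversarial GEC},$$ with $d_{\mathrm{GEC}}$ (the self-play GEC and the adversarial GEC) satisfying $$d_{\mathrm{GEC}}=16H^3d\log\Big(1+\frac{HT}{\epsilon}\Big).$$
   Context: **FOMG.** An episodic two-player zero-sum fully observable Markov game has state space $\mathcal S$, action spaces $\mathcal A,\mathcal B$, episode length $H$, transition kernels $\mathbb P_h(s'|s,a,b)$, rewards $r_h(s,a,b)\in[0,1]$, and a fixed initial state $s_1$. Policies $\pi=\{\pi_h(a|s)\}$, $\nu=\{\nu_h(b|s)\}$ are Markovian. The transition kernel is unknown and is approximated by models $f$ in a model class $\mathcal F$. A model $f$ specifies transition kernels $\mathbb P_{f,h}$, and $V_f^{\pi,\nu}$ is the expected value of $\sum_{h=1}^Hr_h(s_h,a_h,b_h)$ under $\pi,\nu,\mathbb P_f$. The true model is $f^*\in\mathcal F$. The number of episodes is $T$. **Linear MG.** An FOMG such that $r_h(s,a,b)=\mathbf w_h^\top\phi(s,a,b)$ and $\mathbb P_h(s'|s,a,b)=\theta_h(s')^\top\phi(s,a,b)$, with a known feature map $\phi:\mathcal S\times\mathcal A\times\mathcal B\to\mathbb R^d$ and unknown $\mathbf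 w_h,\theta_h(s')\in\mathbb R^d$, satisfying $\|\phi(s,a,b)\|_2\le1$, $\int_{\mathcal S}\|\theta_h(s)\|_2\,\mathrm ds\le\sqrt d$, $\|\mathbf w_h\|_2\le\sqrt d$. All models in $\mathcal F$ have this structure, with $\mathbb P_{f,h}(s'|s,a,b)=\theta_{f,h}(s')^\top\phi(s,a,b)$. **Hellinger distance.** $D_{\mathrm{He}}^2(P,Q)=\frac12\,\mathbb E_{x\sim P}\big(\sqrt{\mathrm dQ(x)/\mathrm dP(x)}-1\big)^2$. **GEC.** Let $\sigma^t=(\pi^t,\nu^t)$ be the joint exploration policy, and let $\mathbb E_{(\sigma,h)}$ denote expectation over the data point $\xi_h$ collected by executing $\sigma$ in the true model up to step $h$. *Self-play GEC.* For any sequences $f^t,g^t\in\mathcal F$, suppose $(\pi^t,\nu^t)$ satisfies (a) $\pi^t=\arg\max_\pi\min_\nu V_{f^t}^{\pi,\nu}$ and $\nu^t=\arg\min_\nu V_{g^t}^{\pi^t,\nu}$, or (b) $\nu^t=\arg\min_\nu\max_\pi V_{f^t}^{\pi,\nu}$ and $\pi^t=\arg\max_\pi V_{g^t}^{\pi,\nu^t}$. The self-play GEC $d_{\mathrm{GEC}}$ is the minimal constant $D$ such that, for any $\rho\in\{f,g\}$ and any such $(\pi^t,\nu^t)$, $$\Big|\sum_{t=1}^T\big(V^{\pi^t,\nu^t}_{\rho^t}-V^{\pi^t,\nu^t}_{f^*}\big)\Big|\le\Big[D\sum_{h=1}^H\sum_{t=1}^T\sum_{\tau=1}^{t-1}\mathbb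 E_{(\sigma^\tau,h)}\ell(\rho^t,\xi_h^\tau)\Big]^{1/2}+2H(DHT)^{1/2}+\epsilon HT .$$ *Adversarial GEC.* For any sequence $f^t\in\mathcal F$ and any sequence of opponent policies $\nu^t$, let $\pi^t=\arg\max_\pi\min_\nu V_{f^t}^{\pi,\nu}$. The adversarial GEC $d_{\mathrm{GEC}}$ is the minimal constant $D$ such that $$\sum_{t=1}^T\big(V^{\pi^t,\nu^t}_{f^t}-V^{\pi^t,\nu^t}_{f^*}\big)\le\Big[D\sum_{h=1}^H\sum_{t=1}^T\sum_{\tau=1}^{t-1}\mathbb E_{(\sigma^\tau,h)}\ell(f^t,\xi_h^\tau)\Big]^{1/2}+2H(DHT)^{1/2}+\epsilon HT .$$ A class of games with a low $d_{\mathrm{GEC}}$ is called a low self-play (resp. adversarial) GEC class.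
   Formalization: The equality for the minimal constant d_GEC is false as written (if the model class contains only f*, d_GEC = 0); it is proved that 16H^3 d log(1+HT/ε) satisfies both GEC inequalities, so both minimal constants are at most this value. *)

theory Defs
  imports "HOL-Probability.Probability"
begin

text \<open>
  The measure \<open>states G\<close> is the state space together with the reference measure
  \<open>ds\<close> against which transition densities are taken. For \<open>actA G\<close> and
  \<open>actB G\<close> only the underlying measurable space matters.  Steps are numbered
  from 1 to \<open>horizon G\<close>; kernels, rewards and policies are unconstrained at other indices,
  which nothing below depends on.
\<close>

record ('s, 'a, 'b) game =
  states :: "'s measure"
  actA :: "'a measure"
  actB :: "'b measure"
  horizon :: nat
  reward :: "nat \<Rightarrow> 's \<times> 'a \<times> 'b \<Rightarrow> real"
  init :: 's

text \<open>A model is identified with the transition kernels that it specifies.\<close>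

type_synonym ('s, 'a, 'b) model = "nat \<Rightarrow> 's \<times> 'a \<times> 'b \<Rightarrow> 's measure"
type_synonym ('s, 'a) policy = "nat \<Rightarrow> 's \<Rightarrow> 'a measure"

definition sab :: "('s, 'a, 'b) game \<Rightarrow> ('s \<times> 'a \<times> 'b) measure" where
  "sab G = states G \<Otimes>\<^sub>M (actA G \<Otimes>\<^sub>M actB G)"

definition fomg :: "('s, 'a, 'b) game \<Rightarrow> bool" where
  "fomg G \<longleftrightarrow>
     sigma_finite_measure (states G) \<and>
     init G \<in> space (states G) \<and>
     (\<forall>h\<in>{1..horizon G}. reward G h \<in> borel_measurable (sab G) \<and>
        (\<forall>x\<in>space (sab G). 0 \<le> reward G h x \<and> reward G h x \<le> 1))"

definition models :: "('s, 'a, 'b) game \<Rightarrow> ('s, 'a, 'b) model set" where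
  "models G = {f. \<forall>h\<in>{1..horizon G}. f h \<in> measurable (sab G) (prob_algebra (states G))}"

definition policiesA :: "('s, 'a, 'b) game \<Rightarrow> ('s, 'a) policy set" where
  "policiesA G = {p. \<forall>h\<in>{1..horizon G}. p h \<in> measurable (states G) (prob_algebra (actA G))}"

definition policiesB :: "('s, 'a, 'b) game \<Rightarrow> ('s, 'b) policy set" where
  "policiesB G = {q. \<forall>h\<in>{1..horizon G}. q h \<in> measurable (states G) (prob_algebra (actB G))}"

definition play ::
  "('s, 'a, 'b) game \<Rightarrow> ('s, 'a) policy \<Rightarrow> ('s, 'b) policy \<Rightarrow> nat \<Rightarrow> 's \<Rightarrow> ('s \<times> 'a \<times> 'b) measure"
where
  "play G \<pi> \<nu> h s = \<pi> h s \<bind> (\<lambda>a. \<nu> h s \<bind> (\<lambda>b. return (sab G) (s, a, b)))"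

definition next_state ::
  "('s, 'a, 'b) game \<Rightarrow> ('s, 'a, 'b) model \<Rightarrow> nat \<Rightarrow> (nat \<Rightarrow> 's \<times> 'a \<times> 'b) \<Rightarrow> 's measure"
where
  "next_state G f h \<omega> = (if h = 0 then return (states G) (init G) else f h (\<omega> h))"

text \<open>
  \<open>traj G f \<pi> \<nu> h\<close> is the law of
  \<open>(s\<^sub>1, a\<^sub>1, b\<^sub>1), \<dots>, (s\<^sub>h, a\<^sub>h, b\<^sub>h)\<close>, as a function on \<open>{1..h}\<close>.
\<close>

primrec traj ::
  "('s, 'a, 'b) game \<Rightarrow> ('s, 'a, 'b) model \<Rightarrow> ('s, 'a) policy \<Rightarrow> ('s, 'b) policy \<Rightarrow>
   nat \<Rightarrow> (nat \<Rightarrow> 's \<times> 'a \<times> 'b) measure"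
where
  "traj G f \<pi> \<nu> 0 = return (PiM {1..0} (\<lambda>_. sab G)) (\<lambda>_. undefined)"
| "traj G f \<pi> \<nu> (Suc h) =
     traj G f \<pi> \<nu> h \<bind> (\<lambda>\<omega>. next_state G f h \<omega> \<bind> (\<lambda>s. play G \<pi> \<nu> (Suc h) s \<bind>
       (\<lambda>x. return (PiM {1..Suc h} (\<lambda>_. sab G)) (fun_upd \<omega> (Suc h) x))))"

definition val ::
  "('s, 'a, 'b) game \<Rightarrow> ('s, 'a, 'b) model \<Rightarrow> ('s, 'a) policy \<Rightarrow> ('s, 'b) policy \<Rightarrow> real"
where
  "val G f \<pi> \<nu> = (\<integral>\<omega>. (\<Sum>h=1..horizon G. reward G h (\<omega> h)) \<partial>traj G f \<pi> \<nu> (horizon G))"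

definition data_expectation ::
  "('s, 'a, 'b) game \<Rightarrow> ('s, 'a, 'b) model \<Rightarrow> ('s, 'a) policy \<Rightarrow> ('s, 'b) policy \<Rightarrow>
   nat \<Rightarrow> ('s \<times> 'a \<times> 'b \<Rightarrow> real) \<Rightarrow> real"
where
  "data_expectation G f \<pi> \<nu> h u = (\<integral>\<omega>. u (\<omega> h) \<partial>traj G f \<pi> \<nu> h)"

text \<open>
  \<open>F\<close> is the model class and \<open>fs \<in> F\<close> the true model.  The identity
  \<open>P\<^sub>h(s' | x) = \<theta>\<^sub>h(s') \<bullet> \<phi>(x)\<close> is one between densities with respect to
  \<open>states G\<close>, hence required for almost every \<open>s'\<close>; the nonnegativity clause is part of
  it because \<open>ennreal\<close> would truncate negative values.
\<close>

definition linear_mg ::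
  "('s, 'a, 'b) game \<Rightarrow> ('s \<times> 'a \<times> 'b \<Rightarrow> real ^ 'd) \<Rightarrow> ('s, 'a, 'b) model set \<Rightarrow>
   ('s, 'a, 'b) model \<Rightarrow> bool"
where
  "linear_mg G \<phi> F fs \<longleftrightarrow>
     fomg G \<and> F \<subseteq> models G \<and> fs \<in> F \<and>
     \<phi> \<in> borel_measurable (sab G) \<and> (\<forall>x\<in>space (sab G). norm (\<phi> x) \<le> 1) \<and>
     (\<forall>h\<in>{1..horizon G}. \<exists>w. norm w \<le> sqrt CARD('d) \<and>
        (\<forall>x\<in>space (sab G). reward G h x = w \<bullet> \<phi> x)) \<and>
     (\<forall>f\<in>F. \<forall>h\<in>{1..horizon G}. \<exists>\<theta>.
        \<theta> \<in> borel_measurable (states G) \<and>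
        (\<integral>\<^sup>+ s. ennreal (norm (\<theta> s)) \<partial>states G) \<le> ennreal (sqrt CARD('d)) \<and>
        (\<forall>x\<in>space (sab G).
           (AE s' in states G. 0 \<le> \<theta> s' \<bullet> \<phi> x) \<and>
           f h x = density (states G) (\<lambda>s'. ennreal (\<theta> s' \<bullet> \<phi> x))))"

text \<open>
  \<open>deriv_ac Q P\<close> is \<open>dQ/dP\<close> in the sense of Lebesgue decomposition: the density with
  respect to \<open>P\<close> of the part of \<open>Q\<close> off a \<open>P\<close>-null set.  This is the ratio \<open>q/p\<close> of densities,
  which makes sense \<open>P\<close>-almost everywhere even if \<open>Q\<close> is not absolutely continuous with respect
  to \<open>P\<close>, whereas \<open>RN_deriv P Q\<close> is 0 by convention in that case.
\<close>

definition deriv_ac :: "'x measure \<Rightarrow> 'x measure \<Rightarrow> 'x \<Rightarrow> ennreal" where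
  "deriv_ac Q P = (SOME g. g \<in> borel_measurable P \<and>
     (\<exists>N\<in>null_sets P. \<forall>A\<in>sets P. emeasure Q (A - N) = (\<integral>\<^sup>+ x\<in>A. g x \<partial>P)))"

definition hellinger_sq :: "'x measure \<Rightarrow> 'x measure \<Rightarrow> real" where
  "hellinger_sq P Q = 1 / 2 * (\<integral>x. (sqrt (enn2real (deriv_ac Q P x)) - 1)\<^sup>2 \<partial>P)"

lemma deriv_ac_eq_RN_deriv:
  assumes "sigma_finite_measure P" and ac: "absolutely_continuous P Q" and sets: "sets Q = sets P"
  shows "AE x in P. deriv_ac Q P x = RN_deriv P Q x"
proof -
  interpret sigma_finite_measure P by fact
  let ?ok = "\<lambda>g. g \<in> borel_measurable P \<and>
     (\<exists>N\<in>null_sets P. \<forall>A\<in>sets P. emeasure Q (A - N) = (\<integral>\<^sup>+ x\<in>A. g x \<partial>P))"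
  have dens: "density P (RN_deriv P Q) = Q"
    using density_RN_deriv[OF ac sets] .
  have "?ok (RN_deriv P Q)"
    by (intro conjI bexI[of _ "{}"] ballI) (auto simp: emeasure_density[symmetric] dens)
  then have "?ok (deriv_ac Q P)"
    unfolding deriv_ac_def by (rule someI[of ?ok])
  then obtain N where m: "deriv_ac Q P \<in> borel_measurable P" and N: "N \<in> null_sets P"
    and eq: "\<And>A. A \<in> sets P \<Longrightarrow> emeasure Q (A - N) = (\<integral>\<^sup>+ x\<in>A. deriv_ac Q P x \<partial>P)"
    by blast
  have NQ: "N \<in> null_sets Q"
    using N ac by (auto simp: absolutely_continuous_def)
  have "density P (deriv_ac Q P) = Q"
  proof (rule measure_eqI)
    fix A assume "A \<in> sets (density P (deriv_ac Q P))"
    then have A: "A \<in> sets P" by simp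
    have "emeasure (density P (deriv_ac Q P)) A = emeasure Q (A - N)"
      using A m eq by (simp add: emeasure_density)
    also have "\<dots> = emeasure Q A"
      using A NQ sets by (simp add: emeasure_Diff_null_set)
    finally show "emeasure (density P (deriv_ac Q P)) A = emeasure Q A" .
  qed (simp add: sets)
  then show ?thesis
    by (rule RN_deriv_unique[OF m])
qed

definition hellinger_loss ::
  "('s, 'a, 'b) model \<Rightarrow> ('s, 'a, 'b) model \<Rightarrow> nat \<Rightarrow> 's \<times> 'a \<times> 'b \<Rightarrow> real"
where
  "hellinger_loss fs f h \<xi> = hellinger_sq (f h \<xi>) (fs h \<xi>)"

definition gec_rhs ::
  "('s, 'a, 'b) game \<Rightarrow> ('s, 'a, 'b) model \<Rightarrow>
   (('s, 'a, 'b) model \<Rightarrow> nat \<Rightarrow> 's \<times> 'a \<times> 'b \<Rightarrow> real) \<Rightarrow> real \<Rightarrow> nat \<Rightarrow>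
   (nat \<Rightarrow> ('s, 'a, 'b) model) \<Rightarrow> (nat \<Rightarrow> ('s, 'a) policy) \<Rightarrow> (nat \<Rightarrow> ('s, 'b) policy) \<Rightarrow>
   real \<Rightarrow> real"
where
  "gec_rhs G fs l \<epsilon> T \<rho> \<pi> \<nu> D =
     sqrt (D * (\<Sum>h=1..horizon G. \<Sum>t=1..T. \<Sum>\<tau>=1..<t.
       data_expectation G fs (\<pi> \<tau>) (\<nu> \<tau>) h (l (\<rho> t) h)))
     + 2 * real (horizon G) * sqrt (D * real (horizon G) * real T)
     + \<epsilon> * real (horizon G) * real T"

text \<open>
  Since minima and maxima over all policies need not be attained on general spaces, the inner
  \<open>min\<close> and \<open>max\<close> are rendered as infimum and supremum; values lie in \<open>[0, H]\<close>.
\<close>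

definition maximin ::
  "('s, 'a, 'b) game \<Rightarrow> ('s, 'a, 'b) model \<Rightarrow> ('s, 'a) policy \<Rightarrow> bool"
where
  "maximin G f \<pi> \<longleftrightarrow>
     is_arg_max (\<lambda>p. INF q\<in>policiesB G. val G f p q) (\<lambda>p. p \<in> policiesA G) \<pi>"

definition minimax ::
  "('s, 'a, 'b) game \<Rightarrow> ('s, 'a, 'b) model \<Rightarrow> ('s, 'b) policy \<Rightarrow> bool"
where
  "minimax G f \<nu> \<longleftrightarrow>
     is_arg_min (\<lambda>q. SUP p\<in>policiesA G. val G f p q) (\<lambda>q. q \<in> policiesB G) \<nu>"

definition self_play_pair ::
  "('s, 'a, 'b) game \<Rightarrow> ('s, 'a, 'b) model \<Rightarrow> ('s, 'a, 'b) model \<Rightarrow>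
   ('s, 'a) policy \<Rightarrow> ('s, 'b) policy \<Rightarrow> bool"
where
  "self_play_pair G f g \<pi> \<nu> \<longleftrightarrow>
     (maximin G f \<pi> \<and> is_arg_min (\<lambda>q. val G g \<pi> q) (\<lambda>q. q \<in> policiesB G) \<nu>) \<or>
     (minimax G f \<nu> \<and> is_arg_max (\<lambda>p. val G g p \<nu>) (\<lambda>p. p \<in> policiesA G) \<pi>)"

text \<open>
  \<open>0 \<le> D\<close> is needed because \<open>sqrt\<close> is defined on negative reals as well.
\<close>

definition self_play_admissible ::
  "('s, 'a, 'b) game \<Rightarrow> ('s, 'a, 'b) model set \<Rightarrow> ('s, 'a, 'b) model \<Rightarrow>
   (('s, 'a, 'b) model \<Rightarrow> nat \<Rightarrow> 's \<times> 'a \<times> 'b \<Rightarrow> real) \<Rightarrow> real \<Rightarrow> nat \<Rightarrow> real \<Rightarrow> bool"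
where
  "self_play_admissible G F fs l \<epsilon> T D \<longleftrightarrow> 0 \<le> D \<and>
     (\<forall>f g \<pi> \<nu>. (\<forall>t\<in>{1..T}. f t \<in> F \<and> g t \<in> F \<and> self_play_pair G (f t) (g t) (\<pi> t) (\<nu> t)) \<longrightarrow>
        (\<forall>\<rho>\<in>{f, g}. \<bar>\<Sum>t=1..T. val G (\<rho> t) (\<pi> t) (\<nu> t) - val G fs (\<pi> t) (\<nu> t)\<bar>
                     \<le> gec_rhs G fs l \<epsilon> T \<rho> \<pi> \<nu> D))"

definition adversarial_admissible ::
  "('s, 'a, 'b) game \<Rightarrow> ('s, 'a, 'b) model set \<Rightarrow> ('s, 'a, 'b) model \<Rightarrow>
   (('s, 'a, 'b) model \<Rightarrow> nat \<Rightarrow> 's \<times> 'a \<times> 'b \<Rightarrow> real) \<Rightarrow> real \<Rightarrow> nat \<Rightarrow> real \<Rightarrow> bool"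
where
  "adversarial_admissible G F fs l \<epsilon> T D \<longleftrightarrow> 0 \<le> D \<and>
     (\<forall>f \<pi> \<nu>. (\<forall>t\<in>{1..T}. f t \<in> F \<and> maximin G (f t) (\<pi> t) \<and> \<nu> t \<in> policiesB G) \<longrightarrow>
        (\<Sum>t=1..T. val G (f t) (\<pi> t) (\<nu> t) - val G fs (\<pi> t) (\<nu> t))
          \<le> gec_rhs G fs l \<epsilon> T f \<pi> \<nu> D)"

definition self_play_gec ::
  "('s, 'a, 'b) game \<Rightarrow> ('s, 'a, 'b) model set \<Rightarrow> ('s, 'a, 'b) model \<Rightarrow>
   (('s, 'a, 'b) model \<Rightarrow> nat \<Rightarrow> 's \<times> 'a \<times> 'b \<Rightarrow> real) \<Rightarrow> real \<Rightarrow> nat \<Rightarrow> real"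
where
  "self_play_gec G F fs l \<epsilon> T = Inf {D. self_play_admissible G F fs l \<epsilon> T D}"

definition adversarial_gec ::
  "('s, 'a, 'b) game \<Rightarrow> ('s, 'a, 'b) model set \<Rightarrow> ('s, 'a, 'b) model \<Rightarrow>
   (('s, 'a, 'b) model \<Rightarrow> nat \<Rightarrow> 's \<times> 'a \<times> 'b \<Rightarrow> real) \<Rightarrow> real \<Rightarrow> nat \<Rightarrow> real"
where
  "adversarial_gec G F fs l \<epsilon> T = Inf {D. adversarial_admissible G F fs l \<epsilon> T D}"

text \<open>The infima are minima as soon as some constant is admissible.\<close>

lemma continuous_gec_rhs: "continuous_on UNIV (gec_rhs G fs l \<epsilon> T \<rho> \<pi> \<nu>)"
  unfolding gec_rhs_def by (intro continuous_intros)

lemma self_play_gec_admissible: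
  assumes "self_play_admissible G F fs l \<epsilon> T D"
  shows "self_play_admissible G F fs l \<epsilon> T (self_play_gec G F fs l \<epsilon> T)"
proof -
  have "closed {D. self_play_admissible G F fs l \<epsilon> T D}"
    unfolding self_play_admissible_def imp_conv_disj Ball_def
    by (intro closed_Collect_conj closed_Collect_all closed_Collect_disj closed_Collect_const
        closed_Collect_le continuous_intros continuous_gec_rhs)
  moreover have "bdd_below {D. self_play_admissible G F fs l \<epsilon> T D}"
    by (auto simp: self_play_admissible_def bdd_below_def)
  ultimately have "Inf {D. self_play_admissible G F fs l \<epsilon> T D} \<in> {D. self_play_admissible G F fs l \<epsilon> T D}"
    using assms by (intro closed_contains_Inf) auto
  then show ?thesis by (simp add: self_play_gec_def)
qed

lemma adversarial_gec_admissible: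
  assumes "adversarial_admissible G F fs l \<epsilon> T D"
  shows "adversarial_admissible G F fs l \<epsilon> T (adversarial_gec G F fs l \<epsilon> T)"
proof -
  have "closed {D. adversarial_admissible G F fs l \<epsilon> T D}"
    unfolding adversarial_admissible_def imp_conv_disj
    by (intro closed_Collect_conj closed_Collect_all closed_Collect_disj closed_Collect_const
        closed_Collect_le continuous_intros continuous_gec_rhs)
  moreover have "bdd_below {D. adversarial_admissible G F fs l \<epsilon> T D}"
    by (auto simp: adversarial_admissible_def bdd_below_def)
  ultimately have "Inf {D. adversarial_admissible G F fs l \<epsilon> T D} \<in> {D. adversarial_admissible G F fs l \<epsilon> T D}"
    using assms by (intro closed_contains_Inf) auto
  then show ?thesis by (simp add: adversarial_gec_def)
qed

end

theory Submission imports Defs begin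

text \<open>
  By the simulation lemma, the value error of a model \<open>f\<close> is the sum over steps \<open>h\<close> of the
  expectation, over trajectories of the true model, of the difference of the integrals of the value
  function of \<open>f\<close> against the two transition kernels.  In a linear game this is an inner
  product \<open>v \<bullet> \<mu>\<close>, where \<open>v\<close> depends on the model and \<open>\<mu>\<close> is the mean feature
  vector at step \<open>h\<close>.  The squares of these inner products with past \<open>\<mu>\<close>s are at most
  \<open>8 H\<^sup>2\<close> times the expected Hellinger loss, and the elliptical potential argument with
  regularisation \<open>1 / d\<close> passes from past errors to present ones.  The determinant is bounded by
  \<open>d! (1 + d T)\<^sup>d\<close>, which is below \<open>(1 + H T / \<epsilon>)\<^bsup>2 d\<^esup>\<close> for large \<open>T\<close>.
\<close>

text \<open>The constant \<open>16\<close> is \<open>8 * 2\<close>: the 8 belongs to the Hellinger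
  comparison, and the 2 allows the log-determinant twice its growth \<open>d ln T\<close>. The spare
  \<open>d ln T\<close> pays for \<open>ln (d!)\<close>, \<open>d ln d\<close> and the constants in
  \<open>H / \<epsilon>\<close>; this is where large \<open>T\<close> enters, and why a crude
  determinant bound suffices. Two powers of \<open>H\<close> come from the range
  \<open>[0, H]\<close> of value functions, the third from Cauchy-Schwarz over the steps.

  The regularisation \<open>1 / d\<close> is dictated by \<open>norm v \<le> 2 * H * sqrt d\<close>:
  it costs \<open>4 * H^2\<close> per round, free of \<open>d\<close>. This cost and the loss of the
  current round, which the GEC sum over \<open>\<tau> < t\<close> omits, are absorbed by
  \<open>2 * H * sqrt (D * H * T)\<close>.

  The vector \<open>v\<close> of round \<open>t\<close> is tested against mean features of earlier
  policies. This works because the Hellinger bound holds at every state-action triple and so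
  survives averaging over any policies. The resulting estimate bounds an absolute value for all
  pairs of policies, hence yields both forms of GEC at once.\<close>

section \<open>Elliptical potential\<close>

lemma det_replace_row_add_multiples:
  fixes A :: "real^'n^'n" and v :: "real^'n"
  assumes "finite S" "k \<notin> S"
  shows "det (\<chi> i. if i = k then v else if i \<in> S then A $ i + c i *s v else A $ i) =
         det (\<chi> i. if i = k then v else A $ i)"
  using assms
proof (induction S)
  case empty
  then show ?case by (simp cong: if_cong)
next
  case (insert j S)
  let ?Z = "\<chi> i. if i = k then v else if i \<in> S then A $ i + c i *s v else A $ i"
  have jk: "j \<noteq> k" using insert by auto
  have "(\<chi> i. if i = k then v else if i \<in> insert j S then A $ i + c i *s v else A $ i) =
        (\<chi> i. if i = j then row j ?Z + c j *s row k ?Z else row i ?Z)"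
    using insert jk by (auto simp: vec_eq_iff row_def)
  then show ?case
    using det_row_operation[OF jk, of ?Z "c j"] insert by simp
qed

text \<open>In the multilinear expansion every term with two rows proportional to \<open>v\<close>
  vanishes, so only first-order terms in \<open>c\<close> remain. The induction splits one row at a
  time; in the part where that row is \<open>v\<close>, row operations clear the multiples of
  \<open>v\<close> from the other rows.\<close>

lemma det_add_multiples_of_row:
  fixes A :: "real^'n^'n" and v :: "real^'n"
  assumes "finite S"
  shows "det (\<chi> i. if i \<in> S then A $ i + c i *s v else A $ i) =
         det A + (\<Sum>k\<in>S. c k * det (\<chi> i. if i = k then v else A $ i))"
  using assms
proof (induction S)
  case empty
  then show ?case by simp
next
  case (insert k S)
  let ?B = "\<lambda>i. if i \<in> S then A $ i + c i *s v else A $ i"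
  have "(\<chi> i. if i \<in> insert k S then A $ i + c i *s v else A $ i) =
        (\<chi> i. if i = k then (\<lambda>i. A $ i) i + (\<lambda>i. c k *s v) i else ?B i)"
    using insert by (auto simp: vec_eq_iff)
  then have "det (\<chi> i. if i \<in> insert k S then A $ i + c i *s v else A $ i) =
      det (\<chi> i. if i = k then A $ i else ?B i) + det (\<chi> i. if i = k then c k *s v else ?B i)"
    by (simp only: det_row_add)
  also have "(\<chi> i. if i = k then A $ i else ?B i) = (\<chi> i. ?B i)"
    using insert by (auto simp: vec_eq_iff)
  also have "det (\<chi> i. if i = k then c k *s v else ?B i) =
      c k * det (\<chi> i. if i = k then v else ?B i)"
    by (rule det_row_mul)
  also have "det (\<chi> i. if i = k then v else ?B i) = det (\<chi> i. if i = k then v else A $ i)"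
    using insert by (intro det_replace_row_add_multiples) auto
  finally show ?case
    using insert by simp
qed

text \<open>The matrix determinant lemma, with the added row written as \<open>y v* A\<close> so
  that no inverse of \<open>A\<close> appears. By Cramer's rule, replacing row \<open>k\<close> by
  this combination of rows multiplies the determinant by \<open>y $ k\<close>.\<close>

lemma det_rank_one_update:
  fixes A :: "real^'n^'n" and u y :: "real^'n"
  shows "det (\<chi> i j. A $ i $ j + u $ i * (y v* A) $ j) = (1 + u \<bullet> y) * det A"
proof -
  have y: "(\<Sum>i\<in>UNIV. y $ i *s row i A) = y v* A"
    by (simp add: vec_eq_iff vector_matrix_mult_def row_def mult.commute)
  have "(\<chi> i j. A $ i $ j + u $ i * (y v* A) $ j) =
      (\<chi> i. if i \<in> UNIV then A $ i + u $ i *s (y v* A) else A $ i)"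
    by (simp add: vec_eq_iff)
  then have "det (\<chi> i j. A $ i $ j + u $ i * (y v* A) $ j) =
      det A + (\<Sum>k\<in>UNIV. u $ k * det (\<chi> i. if i = k then y v* A else A $ i))"
    using det_add_multiples_of_row[OF finite, of UNIV A "\<lambda>i. u $ i" "y v* A"] by simp
  also have "\<dots> = det A + (\<Sum>k\<in>UNIV. u $ k * (y $ k * det A))"
  proof -
    have "det (\<chi> i. if i = k then y v* A else A $ i) = y $ k * det A" for k
      using cramer_lemma_transpose[of k y A]
      unfolding y by (simp add: row_def cong: if_cong)
    then show ?thesis by simp
  qed
  also have "\<dots> = (1 + u \<bullet> y) * det A"
    by (simp add: inner_vec_def algebra_simps sum_distrib_left)
  finally show ?thesis .
qed

text \<open>The Leibniz formula has \<open>d!\<close> terms, each a product of \<open>d\<close>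
  entries. This is cruder than Hadamard's inequality, but only its logarithm matters later.\<close>

lemma abs_det_le:
  fixes A :: "real^'n^'n"
  assumes "\<And>i j. \<bar>A $ i $ j\<bar> \<le> M"
  shows "\<bar>det A\<bar> \<le> fact CARD('n) * M ^ CARD('n)"
proof -
  have "\<bar>det A\<bar> \<le> (\<Sum>p | p permutes (UNIV :: 'n set). \<bar>of_int (sign p) * (\<Prod>i\<in>UNIV. A $ i $ p i)\<bar>)"
    unfolding det_def by (rule sum_abs)
  also have "\<dots> \<le> (\<Sum>p | p permutes (UNIV :: 'n set). M ^ CARD('n))"
  proof (rule sum_mono)
    fix p :: "'n \<Rightarrow> 'n"
    have "\<bar>of_int (sign p) * (\<Prod>i\<in>UNIV. A $ i $ p i)\<bar> = (\<Prod>i\<in>UNIV. \<bar>A $ i $ p i\<bar>)"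
      by (simp add: abs_mult abs_prod sign_def)
    also have "\<dots> \<le> (\<Prod>i\<in>(UNIV :: 'n set). M)"
      using assms by (intro prod_mono) auto
    finally show "\<bar>of_int (sign p) * (\<Prod>i\<in>UNIV. A $ i $ p i)\<bar> \<le> M ^ CARD('n)" by simp
  qed
  also have "\<dots> = fact CARD('n) * M ^ CARD('n)"
    using card_permutations[of "UNIV :: 'n set" "CARD('n)"] by simp
  finally show ?thesis .
qed

section \<open>The regularised Gram matrix and its log-determinant\<close>

definition gram :: "real \<Rightarrow> (nat \<Rightarrow> real^'n) \<Rightarrow> nat \<Rightarrow> real^'n^'n" where
  "gram c x n = (\<chi> i j. (if i = j then c else 0) + (\<Sum>t=1..n. x t $ i * x t $ j))"

text \<open>Positivity and symmetry of the form, and the weights in the potential argument, are read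
  off from this expansion.\<close>

lemma inner_gram:
  fixes u v :: "real^'n"
  shows "v \<bullet> (u v* gram c x n) = c * (v \<bullet> u) + (\<Sum>t=1..n. (v \<bullet> x t) * (u \<bullet> x t))"
proof -
  have 1: "(u v* gram c x n) $ j = c * u $ j + (\<Sum>t=1..n. (u \<bullet> x t) * x t $ j)" for j
  proof -
    have "(u v* gram c x n) $ j =
        (\<Sum>i\<in>UNIV. (if i = j then c * u $ i else 0) + (\<Sum>t=1..n. x t $ i * x t $ j) * u $ i)"
      unfolding vector_matrix_mult_def gram_def
      by (auto simp: algebra_simps intro!: sum.cong)
    also have "\<dots> = c * u $ j + (\<Sum>i\<in>UNIV. \<Sum>t=1..n. x t $ i * x t $ j * u $ i)"
      by (simp add: sum.distrib sum_distrib_right)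
    also have "(\<Sum>i\<in>UNIV. \<Sum>t=1..n. x t $ i * x t $ j * u $ i) = (\<Sum>t=1..n. (u \<bullet> x t) * x t $ j)"
      by (subst sum.swap) (simp add: inner_vec_def sum_distrib_left sum_distrib_right mult_ac)
    finally show ?thesis .
  qed
  have "v \<bullet> (u v* gram c x n) = (\<Sum>j\<in>UNIV. c * (v $ j * u $ j) + (\<Sum>t=1..n. (u \<bullet> x t) * (v $ j * x t $ j)))"
    by (simp add: inner_vec_def[of v] 1 algebra_simps sum_distrib_left)
  also have "\<dots> = c * (v \<bullet> u) + (\<Sum>j\<in>UNIV. \<Sum>t=1..n. (u \<bullet> x t) * (v $ j * x t $ j))"
    by (simp add: sum.distrib inner_vec_def sum_distrib_left)
  also have "(\<Sum>j\<in>UNIV. \<Sum>t=1..n. (u \<bullet> x t) * (v $ j * x t $ j)) = (\<Sum>t=1..n. (v \<bullet> x t) * (u \<bullet> x t))"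
    by (subst sum.swap) (simp add: inner_vec_def[of v] sum_distrib_left mult_ac)
  finally show ?thesis .
qed

lemma gram_form_cauchy_schwarz:
  fixes u v :: "real^'n"
  assumes "0 \<le> c"
  shows "(v \<bullet> (u v* gram c x n))\<^sup>2 \<le> (v \<bullet> (v v* gram c x n)) * (u \<bullet> (u v* gram c x n))"
proof -
  define Q where "Q a b = a \<bullet> (b v* gram c x n)" for a b :: "real^'n"
  have pos: "0 \<le> Q a a" for a
    unfolding Q_def inner_gram using assms by (auto intro!: add_nonneg_nonneg sum_nonneg)
  have expand: "Q (r *\<^sub>R v + s *\<^sub>R u) (r *\<^sub>R v + s *\<^sub>R u) = r\<^sup>2 * Q v v + 2 * r * s * Q v u + s\<^sup>2 * Q u u" for r s
    unfolding Q_def inner_gram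
    by (simp add: power2_eq_square algebra_simps sum.distrib
        sum_distrib_left inner_commute[of u v])
  show ?thesis
  proof (cases "Q u u = 0")
    case True
    have "Q v u = 0"
    proof (rule ccontr)
      assume "Q v u \<noteq> 0"
      \<comment> \<open>This coefficient of \<open>u\<close> is chosen so that the form would take
        the value \<open>- 1\<close>.\<close>
      moreover have "0 \<le> Q v v + 2 * (- (Q v v + 1) / (2 * Q v u)) * Q v u"
        using pos[of "1 *\<^sub>R v + (- (Q v v + 1) / (2 * Q v u)) *\<^sub>R u"] True
        unfolding expand by simp
      ultimately show False by (simp add: field_simps)
    qed
    then show ?thesis using True unfolding Q_def by simp
  next
    case False
    \<comment> \<open>The coefficients \<open>Q u u\<close> and \<open>- Q v u\<close> give the
      minimiser along \<open>v + s u\<close> with denominators cleared.\<close>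
    have "0 \<le> (Q u u)\<^sup>2 * Q v v + 2 * Q u u * (- Q v u) * Q v u + (- Q v u)\<^sup>2 * Q u u"
      using pos[of "Q u u *\<^sub>R v + (- Q v u) *\<^sub>R u"] unfolding expand .
    then have "0 \<le> Q u u * (Q v v * Q u u - (Q v u)\<^sup>2)"
      by (simp add: algebra_simps power2_eq_square)
    moreover have "0 < Q u u" using False pos[of u] by simp
    ultimately show ?thesis
      unfolding Q_def[symmetric] by (simp add: zero_le_mult_iff)
  qed
qed

lemma det_gram_0: "det (gram c x 0 :: real^'n^'n) = c ^ CARD('n)"
proof -
  have "det (gram c x 0 :: real^'n^'n) = (\<Prod>i\<in>UNIV. gram c x 0 $ i $ i)"
    by (rule det_diagonal) (simp add: gram_def)
  then show ?thesis by (simp add: gram_def)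
qed

lemma gram_Suc:
  "gram c x (Suc n) = (\<chi> i j. gram c x n $ i $ j + x (Suc n) $ i * x (Suc n) $ j)"
  by (simp add: gram_def vec_eq_iff)

text \<open>
  Comparing \<open>v\<close> with the matrix that already contains \<open>x (Suc n)\<close> makes the increments
  \<open>w / (1 + w)\<close> rather than \<open>w\<close>, so that no truncation \<open>min 1 w\<close> is needed.
\<close>

lemma gram_step:
  fixes x :: "nat \<Rightarrow> real^'n"
  assumes c: "0 < c" and pos: "0 < det (gram c x n)"
  shows "0 < det (gram c x (Suc n))"
    and "det (gram c x n) \<le> det (gram c x (Suc n))"
    and "(v \<bullet> x (Suc n))\<^sup>2 \<le> (c * (norm v)\<^sup>2 + (\<Sum>t=1..Suc n. (v \<bullet> x t)\<^sup>2)) *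
           (ln (det (gram c x (Suc n))) - ln (det (gram c x n)))"
proof -
  let ?x = "x (Suc n)"
  have "invertible (transpose (gram c x n))"
    using pos by (simp add: invertible_det_nz)
  then obtain y where y: "y v* gram c x n = ?x"
    by (metis invertible_def matrix_vector_mul_assoc matrix_vector_mul_lid transpose_matrix_vector)
  \<comment> \<open>As the matrix is symmetric, \<open>y\<close> is its inverse applied to
    \<open>x (Suc n)\<close>, and \<open>w\<close> is the squared length of \<open>x (Suc n)\<close>
    in the inverse matrix.\<close>
  define w where "w = ?x \<bullet> y"
  have w: "w = y \<bullet> (y v* gram c x n)"
    by (simp add: w_def y inner_commute)
  then have "w \<ge> 0"
    unfolding inner_gram using c by (auto intro!: add_nonneg_nonneg sum_nonneg)
  have det: "det (gram c x (Suc n)) = (1 + w) * det (gram c x n)"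
    using det_rank_one_update[of "gram c x n" ?x y] by (simp add: gram_Suc y w_def)
  then show pos': "0 < det (gram c x (Suc n))"
    using pos \<open>w \<ge> 0\<close> by simp
  show "det (gram c x n) \<le> det (gram c x (Suc n))"
    using pos \<open>w \<ge> 0\<close> by (simp add: det)
  have ln: "ln (det (gram c x (Suc n))) - ln (det (gram c x n)) = ln (1 + w)"
    using pos \<open>w \<ge> 0\<close> by (simp add: det ln_mult)
  define N where "N = v \<bullet> (v v* gram c x n)"
  have N: "N = c * (norm v)\<^sup>2 + (\<Sum>t=1..n. (v \<bullet> x t)\<^sup>2)"
    unfolding N_def inner_gram by (simp add: power2_norm_eq_inner) (simp add: power2_eq_square)
  then have "N \<ge> 0" using c by (auto intro!: add_nonneg_nonneg sum_nonneg)
  have cs: "(v \<bullet> ?x)\<^sup>2 \<le> N * w"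
    using gram_form_cauchy_schwarz[of c v y x n] c by (simp add: y N_def w)
  \<comment> \<open>Adding \<open>(v \<bullet> x (Suc n))^2 * w\<close> to both sides of
    \<open>cs\<close> turns \<open>N\<close> into the quadratic form of the updated matrix.\<close>
  have "(v \<bullet> ?x)\<^sup>2 * (1 + w) \<le> (N + (v \<bullet> ?x)\<^sup>2) * w"
    using cs by (simp add: algebra_simps)
  then have "(v \<bullet> ?x)\<^sup>2 \<le> (N + (v \<bullet> ?x)\<^sup>2) * (w / (1 + w))"
    using \<open>w \<ge> 0\<close> by (simp add: field_simps)
  also have "\<dots> \<le> (N + (v \<bullet> ?x)\<^sup>2) * ln (1 + w)"
  proof -
    \<comment> \<open>The inequality \<open>w / (1 + w) \<le> ln (1 + w)\<close> is
      \<open>ln z \<le> z - 1\<close> at \<open>z = 1 / (1 + w)\<close>.\<close>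
    have "- ln (1 + w) = ln (1 / (1 + w))"
      using \<open>w \<ge> 0\<close> by (simp add: ln_div)
    also have "\<dots> \<le> 1 / (1 + w) - 1"
      using \<open>w \<ge> 0\<close> by (intro ln_le_minus_one) auto
    finally have "w / (1 + w) \<le> ln (1 + w)" using \<open>w \<ge> 0\<close> by (simp add: field_simps)
    then show ?thesis using \<open>N \<ge> 0\<close> by (intro mult_left_mono) auto
  qed
  finally show "(v \<bullet> ?x)\<^sup>2 \<le> (c * (norm v)\<^sup>2 + (\<Sum>t=1..Suc n. (v \<bullet> x t)\<^sup>2)) *
           (ln (det (gram c x (Suc n))) - ln (det (gram c x n)))"
    unfolding ln by (simp add: N add.assoc)
qed

lemma det_gram_pos:
  assumes "0 < c"
  shows "0 < det (gram c x n)"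
  by (induction n) (use assms gram_step(1) in \<open>auto simp: det_gram_0\<close>)

lemma det_gram_le:
  fixes x :: "nat \<Rightarrow> real^'n"
  assumes "0 < c" and "\<And>t. t \<in> {1..n} \<Longrightarrow> norm (x t) \<le> 1"
  shows "det (gram c x n) \<le> fact CARD('n) * (c + real n) ^ CARD('n)"
proof -
  have "\<bar>gram c x n $ i $ j\<bar> \<le> c + real n" for i j
  proof -
    have "\<bar>x t $ i * x t $ j\<bar> \<le> 1" if "t \<in> {1..n}" for t
      using component_le_norm_cart[of "x t" i] component_le_norm_cart[of "x t" j] assms(2)[OF that]
      by (simp add: abs_mult mult_le_one)
    then have "\<bar>\<Sum>t=1..n. x t $ i * x t $ j\<bar> \<le> (\<Sum>t=1..n. 1)"
      by (intro order_trans[OF sum_abs] sum_mono) auto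
    then show ?thesis using assms(1) by (auto simp: gram_def)
  qed
  then show ?thesis
    using abs_det_le[of "gram c x n" "c + real n"] by simp
qed

text \<open>Each term is at most \<open>sqrt (N t) * sqrt (g t)\<close>, where \<open>g\<close> is
  the increment of the log-determinant. Cauchy-Schwarz over \<open>t\<close> separates the two
  factors, and the increments telescope. The inner sum includes \<open>\<tau> = t\<close> because
  \<open>gram_step\<close> measures \<open>v\<close> in the updated matrix.\<close>

lemma elliptical_potential:
  fixes x v :: "nat \<Rightarrow> real^'n"
  assumes c: "0 < c" and x: "\<And>t. t \<in> {1..T} \<Longrightarrow> norm (x t) \<le> 1"
  shows "(\<Sum>t=1..T. \<bar>v t \<bullet> x t\<bar>) \<le>
    sqrt (\<Sum>t=1..T. c * (norm (v t))\<^sup>2 + (\<Sum>\<tau>=1..t. (v t \<bullet> x \<tau>)\<^sup>2)) *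
    sqrt (ln (fact CARD('n) * (1 + real T / c) ^ CARD('n)))"
proof -
  define N where "N t = c * (norm (v t))\<^sup>2 + (\<Sum>\<tau>=1..t. (v t \<bullet> x \<tau>)\<^sup>2)" for t
  define g where "g t = ln (det (gram c x t)) - ln (det (gram c x (t - 1)))" for t
  have step: "(v t \<bullet> x t)\<^sup>2 \<le> N t * g t" if "t \<in> {1..T}" for t
  proof -
    from that have "Suc (t - 1) = t" by simp
    then show ?thesis
      using gram_step(3)[OF c det_gram_pos[OF c], of "v t" x "t - 1"]
      unfolding N_def g_def by metis
  qed
  have N: "0 \<le> N t" for t
    unfolding N_def using c by (auto intro!: add_nonneg_nonneg sum_nonneg)
  have g: "0 \<le> g t" if "t \<in> {1..T}" for t
    using gram_step(2)[OF c det_gram_pos[OF c], of x "t - 1"] that det_gram_pos[OF c, of x]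
    by (simp add: g_def)
  have tele: "(\<Sum>t=1..n. g t) = ln (det (gram c x n)) - ln (det (gram c x 0))" for n
    by (induction n) (auto simp: g_def)
  \<comment> \<open>The initial matrix has determinant \<open>c ^ d\<close>; subtracting its
    logarithm turns \<open>c + T\<close> into \<open>1 + T / c\<close>.\<close>
  have "(\<Sum>t=1..T. g t) \<le> ln (fact CARD('n) * (c + real T) ^ CARD('n)) - ln (c ^ CARD('n))"
    using det_gram_le[OF c x] det_gram_pos[OF c, of x T]
    unfolding tele det_gram_0 by (intro diff_right_mono ln_mono) auto
  also have "\<dots> = ln (fact CARD('n) * (1 + real T / c) ^ CARD('n))"
  proof -
    have "(1 + real T / c) = (c + real T) / c" using c by (simp add: field_simps)
    then show ?thesis using c by (simp add: ln_mult ln_div power_divide add_pos_nonneg)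
  qed
  finally have G: "(\<Sum>t=1..T. g t) \<le> ln (fact CARD('n) * (1 + real T / c) ^ CARD('n))" .
  have "(\<Sum>t=1..T. \<bar>v t \<bullet> x t\<bar>) \<le> (\<Sum>t=1..T. sqrt (N t) * sqrt (g t))"
    using step by (intro sum_mono) (metis real_sqrt_abs real_sqrt_le_mono real_sqrt_mult)
  also have "\<dots> \<le> sqrt (\<Sum>t=1..T. N t) * sqrt (\<Sum>t=1..T. g t)"
  proof (rule power2_le_imp_le)
    have "(\<Sum>t=1..T. sqrt (N t) * sqrt (g t))\<^sup>2 \<le> (\<Sum>t=1..T. (sqrt (N t))\<^sup>2) * (\<Sum>t=1..T. (sqrt (g t))\<^sup>2)"
      by (rule Cauchy_Schwarz_ineq_sum)
    also have "\<dots> = (sqrt (\<Sum>t=1..T. N t) * sqrt (\<Sum>t=1..T. g t))\<^sup>2"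
      using N g sum_nonneg[of "{1..T}" g] sum_nonneg[of "{1..T}" N] by (simp add: power_mult_distrib)
    finally show "(\<Sum>t=1..T. sqrt (N t) * sqrt (g t))\<^sup>2 \<le> \<dots>" .
  qed (use N g in \<open>auto intro!: mult_nonneg_nonneg sum_nonneg\<close>)
  also have "\<dots> \<le> sqrt (\<Sum>t=1..T. N t) * sqrt (ln (fact CARD('n) * (1 + real T / c) ^ CARD('n)))"
    using G N by (intro mult_left_mono) (auto intro!: sum_nonneg)
  finally show ?thesis unfolding N_def .
qed

section \<open>Hellinger distance\<close>

text \<open>The property that the choice operator in \<open>deriv_ac\<close> selects for.\<close>

definition ac_density :: "'x measure \<Rightarrow> 'x measure \<Rightarrow> ('x \<Rightarrow> ennreal) \<Rightarrow> bool" where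
  "ac_density Q P g \<longleftrightarrow> g \<in> borel_measurable P \<and>
     (\<exists>N\<in>null_sets P. \<forall>A\<in>sets P. emeasure Q (A - N) = (\<integral>\<^sup>+ x\<in>A. g x \<partial>P))"

lemma ac_density_deriv_ac:
  assumes "ac_density Q P g"
  shows "ac_density Q P (deriv_ac Q P)"
  using someI[of "ac_density Q P", OF assms] unfolding deriv_ac_def ac_density_def .

text \<open>The two candidates may come with different exceptional sets. Both are
  \<open>P\<close>-null, so each integral over \<open>A\<close> can be compared with
  \<open>Q\<close> on \<open>A - N - N'\<close>.\<close>

lemma ac_density_unique:
  assumes "sigma_finite_measure P" and g: "ac_density Q P g" and g': "ac_density Q P g'"
  shows "AE x in P. g x = g' x"
proof -
  interpret sigma_finite_measure P by fact
  obtain N where N: "N \<in> null_sets P"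
    and eq: "\<And>A. A \<in> sets P \<Longrightarrow> emeasure Q (A - N) = (\<integral>\<^sup>+ x\<in>A. g x \<partial>P)"
    using g unfolding ac_density_def by blast
  obtain N' where N': "N' \<in> null_sets P"
    and eq': "\<And>A. A \<in> sets P \<Longrightarrow> emeasure Q (A - N') = (\<integral>\<^sup>+ x\<in>A. g' x \<partial>P)"
    using g' unfolding ac_density_def by blast
  show ?thesis
  proof (rule density_unique2)
    fix A assume A: "A \<in> sets P"
    have "(\<integral>\<^sup>+ x\<in>A. g x \<partial>P) = (\<integral>\<^sup>+ x\<in>A - N'. g x \<partial>P)"
      using AE_not_in[OF N'] by (intro nn_integral_cong_AE) (auto elim!: eventually_mono split: split_indicator)
    also have "\<dots> = emeasure Q (A - N' - N)"
      using A N' by (intro eq[symmetric]) auto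
    also have "A - N' - N = A - N - N'" by auto
    also have "emeasure Q (A - N - N') = (\<integral>\<^sup>+ x\<in>A - N. g' x \<partial>P)"
      using A N by (intro eq') auto
    also have "\<dots> = (\<integral>\<^sup>+ x\<in>A. g' x \<partial>P)"
      using AE_not_in[OF N] by (intro nn_integral_cong_AE) (auto elim!: eventually_mono split: split_indicator)
    finally show "(\<integral>\<^sup>+ x\<in>A. g x \<partial>P) = (\<integral>\<^sup>+ x\<in>A. g' x \<partial>P)" .
  qed (use g g' in \<open>auto simp: ac_density_def\<close>)
qed

text \<open>The exceptional set is where \<open>p\<close> vanishes: it is null for the first measure
  but may carry mass of the second. Off it \<open>p * (q / p) = q\<close>; on it both integrands are
  zero, the right one because of its factor \<open>p\<close>.\<close>

lemma ac_density_density: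
  fixes p q :: "'x \<Rightarrow> real"
  assumes [measurable]: "p \<in> borel_measurable M" "q \<in> borel_measurable M"
    and nn: "\<And>x. 0 \<le> p x" "\<And>x. 0 \<le> q x"
  shows "ac_density (density M q) (density M p) (\<lambda>x. ennreal (q x / p x))"
  unfolding ac_density_def
proof (intro conjI bexI ballI)
  let ?N = "{x \<in> space M. p x = 0}"
  show "?N \<in> null_sets (density M p)"
    by (auto simp: null_sets_density_iff)
  fix A assume "A \<in> sets (density M (\<lambda>x. ennreal (p x)))"
  then have [measurable]: "A \<in> sets M" by simp
  have "emeasure (density M q) (A - ?N) = (\<integral>\<^sup>+ x. ennreal (q x) * indicator (A - ?N) x \<partial>M)"
    by (simp add: emeasure_density)
  also have "\<dots> = (\<integral>\<^sup>+ x. ennreal (p x) * (ennreal (q x / p x) * indicator A x) \<partial>M)"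
    using nn by (intro nn_integral_cong)
      (auto split: split_indicator simp: ennreal_mult'[symmetric])
  also have "\<dots> = (\<integral>\<^sup>+ x\<in>A. ennreal (q x / p x) \<partial>density M p)"
    by (simp add: nn_integral_density)
  finally show "emeasure (density M q) (A - ?N) = (\<integral>\<^sup>+ x\<in>A. ennreal (q x / p x) \<partial>density M p)" .
qed simp

text \<open>The choice in \<open>deriv_ac\<close> is made separately for each pair of measures, so
  it gives no measurable dependence on a parameter. This explicit integrand does, and makes the loss
  a measurable function of the state-action triple.\<close>

lemma hellinger_sq_density:
  fixes p q :: "'x \<Rightarrow> real"
  assumes [measurable]: "p \<in> borel_measurable M" "q \<in> borel_measurable M"
    and nn: "\<And>x. 0 \<le> p x" "\<And>x. 0 \<le> q x"
    and "prob_space (density M p)"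
  shows "hellinger_sq (density M p) (density M q) = 1 / 2 * (\<integral>x. p x * (sqrt (q x / p x) - 1)\<^sup>2 \<partial>M)"
proof -
  let ?P = "density M p" and ?Q = "density M q"
  interpret P: prob_space ?P by fact
  note ac = ac_density_density[OF assms(1,2) nn]
  have [measurable]: "deriv_ac ?Q ?P \<in> borel_measurable M"
    using ac_density_deriv_ac[OF ac] unfolding ac_density_def by simp
  have "AE x in ?P. deriv_ac ?Q ?P x = ennreal (q x / p x)"
    using ac_density_unique[OF P.sigma_finite_measure_axioms ac_density_deriv_ac[OF ac] ac] .
  then have "(\<integral>x. (sqrt (enn2real (deriv_ac ?Q ?P x)) - 1)\<^sup>2 \<partial>?P) =
      (\<integral>x. (sqrt (q x / p x) - 1)\<^sup>2 \<partial>?P)"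
    using nn by (intro integral_cong_AE) (auto elim!: eventually_mono)
  also have "\<dots> = (\<integral>x. p x * (sqrt (q x / p x) - 1)\<^sup>2 \<partial>M)"
    using nn by (subst integral_density) auto
  finally show ?thesis unfolding hellinger_sq_def by simp
qed

lemma (in prob_space) expectation_square_le:
  fixes X :: "'a \<Rightarrow> real"
  assumes "integrable M X" "integrable M (\<lambda>x. (X x)\<^sup>2)"
  shows "(expectation X)\<^sup>2 \<le> expectation (\<lambda>x. (X x)\<^sup>2)"
  using variance_eq[OF assms] variance_positive[of X] by simp

lemma sq_sqrt_minus_one_le:
  fixes r :: real
  assumes "0 \<le> r"
  shows "(sqrt r - 1)\<^sup>2 \<le> r + 1"
  using assms by (simp add: power2_eq_square algebra_simps)

section \<open>Comparing two probability measures through the absolutely continuous part\<close>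

context
  fixes P Q :: "'x measure" and g :: "'x \<Rightarrow> ennreal"
  assumes P: "prob_space P" and Q: "prob_space Q" and sets: "sets Q = sets P"
    and ac: "ac_density Q P g"
begin

interpretation P: prob_space P by fact
interpretation Q: prob_space Q by fact

lemma ac_density_le: "density P g \<le> Q"
proof -
  obtain N where N: "N \<in> null_sets P"
    and eq: "\<And>A. A \<in> sets P \<Longrightarrow> emeasure Q (A - N) = (\<integral>\<^sup>+ x\<in>A. g x \<partial>P)"
    using ac unfolding ac_density_def by blast
  have "emeasure (density P g) A \<le> emeasure Q A" for A
  proof (cases "A \<in> sets P")
    case True
    then have "emeasure (density P g) A = emeasure Q (A - N)"
      using ac by (simp add: eq emeasure_density ac_density_def)
    also have "\<dots> \<le> emeasure Q A"
      using True sets by (intro emeasure_mono) auto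
    finally show ?thesis .
  qed (simp add: emeasure_notin_sets)
  then show ?thesis
    using sets by (subst le_measure) (auto simp: le_fun_def)
qed

lemma ac_density_AE_finite: "AE x in P. g x < \<infinity>"
proof -
  have "(\<integral>\<^sup>+ x. g x \<partial>P) = emeasure (density P g) (space P)"
    using ac by (simp add: emeasure_density ac_density_def cong: nn_integral_cong)
  also have "\<dots> \<le> emeasure Q (space P)"
    by (rule le_measureD3[OF ac_density_le]) (simp add: sets)
  also have "\<dots> \<le> 1"
    by (rule Q.emeasure_le_1)
  finally have "(\<integral>\<^sup>+ x. g x \<partial>P) \<noteq> \<infinity>" by (auto simp: top_unique)
  then show ?thesis
    using ac nn_integral_PInf_AE[of g P] by (auto simp: ac_density_def less_top)
qed

lemma nn_integral_ac_density_le: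
  assumes "U \<in> borel_measurable P"
  shows "(\<integral>\<^sup>+ x. U x * g x \<partial>P) \<le> (\<integral>\<^sup>+ x. U x \<partial>Q)"
proof -
  have "(\<integral>\<^sup>+ x. U x * g x \<partial>P) = (\<integral>\<^sup>+ x. U x \<partial>density P g)"
    using ac assms by (subst nn_integral_density) (auto simp: ac_density_def mult.commute)
  also have "\<dots> \<le> (\<integral>\<^sup>+ x. U x \<partial>Q)"
    using sets by (intro nn_integral_mono_measure ac_density_le) auto
  finally show ?thesis .
qed

text \<open>\<open>g\<close> is finite almost everywhere, so \<open>enn2real\<close> loses nothing
  and the comparison of measures passes to Bochner integrals. The loss of mass in the singular part
  of \<open>Q\<close> makes the second claim an inequality.\<close>

lemma integrable_enn2real_ac_density: "integrable P (\<lambda>x. enn2real (g x))"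
  and integral_ac_density_le:
    "\<lbrakk>U \<in> borel_measurable P; \<And>x. x \<in> space P \<Longrightarrow> 0 \<le> U x; \<And>x. x \<in> space P \<Longrightarrow> U x \<le> B\<rbrakk> \<Longrightarrow>
      (\<integral>x. U x * enn2real (g x) \<partial>P) \<le> (\<integral>x. U x \<partial>Q)" for U :: "'x \<Rightarrow> real"
proof -
  have [measurable]: "g \<in> borel_measurable P" using ac by (simp add: ac_density_def)
  have sp: "space Q = space P" using sets by (rule sets_eq_imp_space_eq)
  have eq: "AE x in P. ennreal (enn2real (g x)) = g x"
    using ac_density_AE_finite by eventually_elim simp
  have "(\<integral>\<^sup>+ x. ennreal (norm (enn2real (g x))) \<partial>P) = (\<integral>\<^sup>+ x. 1 * g x \<partial>P)"
    using eq by (intro nn_integral_cong_AE) auto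
  also have "\<dots> \<le> (\<integral>\<^sup>+ x. 1 \<partial>Q)"
    by (intro nn_integral_ac_density_le) auto
  also have "\<dots> = 1" using Q.emeasure_space_1 by simp
  finally show "integrable P (\<lambda>x. enn2real (g x))"
    by (intro integrableI_bounded) (auto intro: le_less_trans)
  assume [measurable]: "U \<in> borel_measurable P" and U: "\<And>x. x \<in> space P \<Longrightarrow> 0 \<le> U x" "\<And>x. x \<in> space P \<Longrightarrow> U x \<le> B"
  have [measurable]: "U \<in> borel_measurable Q"
    using \<open>U \<in> borel_measurable P\<close> by (simp add: measurable_cong_sets[OF sets refl])
  have UQ: "integrable Q U"
    using U sp by (intro Q.integrable_const_bound[of _ B]) auto
  show "(\<integral>x. U x * enn2real (g x) \<partial>P) \<le> (\<integral>x. U x \<partial>Q)"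
  proof (rule integral_real_bounded)
    show "0 \<le> integral\<^sup>L Q U" using U sp by (intro Bochner_Integration.integral_nonneg) auto
    have "(\<integral>\<^sup>+ x. ennreal (U x * enn2real (g x)) \<partial>P) = (\<integral>\<^sup>+ x. ennreal (U x) * g x \<partial>P)"
      using eq U by (intro nn_integral_cong_AE) (auto simp: ennreal_mult')
    also have "\<dots> \<le> (\<integral>\<^sup>+ x. ennreal (U x) \<partial>Q)"
      by (intro nn_integral_ac_density_le) auto
    also have "\<dots> = ennreal (integral\<^sup>L Q U)"
      using UQ U sp by (intro nn_integral_eq_integral) auto
    finally show "(\<integral>\<^sup>+ x. ennreal (U x * enn2real (g x)) \<partial>P) \<le> ennreal (integral\<^sup>L Q U)" .
  qed
qed

lemma integrable_sq_sqrt_ac_density: "integrable P (\<lambda>x. (sqrt (enn2real (g x)) - 1)\<^sup>2)"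
proof (rule Bochner_Integration.integrable_bound)
  show "integrable P (\<lambda>x. enn2real (g x) + 1)"
    using integrable_enn2real_ac_density by simp
  show "(\<lambda>x. (sqrt (enn2real (g x)) - 1)\<^sup>2) \<in> borel_measurable P"
    using ac by (auto simp: ac_density_def)
  show "AE x in P. norm ((sqrt (enn2real (g x)) - 1)\<^sup>2) \<le> norm (enn2real (g x) + 1)"
    using sq_sqrt_minus_one_le by auto
qed

lemma integral_sq_sqrt_ac_density_le: "(\<integral>x. (sqrt (enn2real (g x)) - 1)\<^sup>2 \<partial>P) \<le> 2"
proof -
  have "(\<integral>x. (sqrt (enn2real (g x)) - 1)\<^sup>2 \<partial>P) \<le> (\<integral>x. enn2real (g x) + 1 \<partial>P)"
  proof (rule Bochner_Integration.integral_mono)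
    show "integrable P (\<lambda>x. (sqrt (enn2real (g x)) - 1)\<^sup>2)"
      by (rule integrable_sq_sqrt_ac_density)
    show "integrable P (\<lambda>x. enn2real (g x) + 1)"
      using integrable_enn2real_ac_density by simp
  qed (simp add: sq_sqrt_minus_one_le)
  also have "\<dots> = (\<integral>x. enn2real (g x) \<partial>P) + 1"
    using integrable_enn2real_ac_density by (simp add: P.prob_space)
  finally show ?thesis
    using integral_ac_density_le[of "\<lambda>_. 1" 1] by (simp add: Q.prob_space)
qed

text \<open>Dropping the singular part of \<open>Q\<close> can only increase the left side, since
  \<open>U\<close> is nonnegative. What remains is the integral of \<open>U * (1 - r)\<close>, with
  \<open>r\<close> the density ratio. Where \<open>r > 1\<close> the integrand is nonpositive; where
  \<open>r \<le> 1\<close> it factors through \<open>(1 + sqrt r) * (1 - sqrt r)\<close>, whose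
  first factor is at most 2. The one-sided form thus avoids the unbounded values of
  \<open>1 + sqrt r\<close>.\<close>

lemma integral_diff_le_ac_density:
  fixes U :: "'x \<Rightarrow> real"
  assumes [measurable]: "U \<in> borel_measurable P"
    and U: "\<And>x. x \<in> space P \<Longrightarrow> 0 \<le> U x" "\<And>x. x \<in> space P \<Longrightarrow> U x \<le> B"
  shows "(\<integral>x. U x \<partial>P) - (\<integral>x. U x \<partial>Q) \<le> 2 * B * (\<integral>x. \<bar>sqrt (enn2real (g x)) - 1\<bar> \<partial>P)"
proof -
  let ?r = "\<lambda>x. enn2real (g x)"
  have [measurable]: "g \<in> borel_measurable P" using ac by (simp add: ac_density_def)
  have iU: "integrable P U"
    using U by (intro P.integrable_const_bound[of _ B]) auto
  have iUr: "integrable P (\<lambda>x. U x * ?r x)"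
  proof (rule Bochner_Integration.integrable_bound)
    show "integrable P (\<lambda>x. B * ?r x)"
      using integrable_enn2real_ac_density by simp
    show "AE x in P. norm (U x * ?r x) \<le> norm (B * ?r x)"
    proof (rule AE_I2)
      fix x assume "x \<in> space P"
      then have "0 \<le> U x" "U x \<le> B" by (rule U)+
      then show "norm (U x * ?r x) \<le> norm (B * ?r x)"
        by (simp add: abs_mult mult_right_mono)
    qed
  qed simp
  have i: "integrable P (\<lambda>x. sqrt (?r x) - 1)"
    by (rule P.square_integrable_imp_integrable[rotated]) (use integrable_sq_sqrt_ac_density in auto)
  have "(\<integral>x. U x \<partial>P) - (\<integral>x. U x \<partial>Q) \<le> (\<integral>x. U x \<partial>P) - (\<integral>x. U x * ?r x \<partial>P)"
    using integral_ac_density_le[of U B] U by simp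
  also have "\<dots> = (\<integral>x. U x * (1 - ?r x) \<partial>P)"
    using iU iUr by (simp add: right_diff_distrib)
  also have "\<dots> \<le> (\<integral>x. 2 * B * \<bar>sqrt (?r x) - 1\<bar> \<partial>P)"
  proof (rule Bochner_Integration.integral_mono)
    show "integrable P (\<lambda>x. U x * (1 - ?r x))"
      using iU iUr by (simp add: right_diff_distrib)
    show "integrable P (\<lambda>x. 2 * B * \<bar>sqrt (?r x) - 1\<bar>)"
      using i by simp
    fix x assume x: "x \<in> space P"
    show "U x * (1 - ?r x) \<le> 2 * B * \<bar>sqrt (?r x) - 1\<bar>"
    proof (cases "?r x \<le> 1")
      case True
      define s where "s = sqrt (?r x)"
      have s: "0 \<le> s" "s \<le> 1" "?r x = s * s" using True by (auto simp: s_def)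
      have "1 - ?r x = (1 + s) * (1 - s)" by (simp add: s algebra_simps)
      also have "\<dots> \<le> 2 * (1 - s)" using s by (intro mult_right_mono) auto
      finally have "U x * (1 - ?r x) \<le> B * (2 * (1 - s))"
        using U[OF x] True by (intro mult_mono) auto
      then show ?thesis using s(2) by (simp add: s_def algebra_simps)
    next
      case False
      then have "U x * (1 - ?r x) \<le> 0" using U[OF x] by (simp add: mult_nonneg_nonpos)
      also have "0 \<le> 2 * B * \<bar>sqrt (?r x) - 1\<bar>" using U[OF x] by auto
      finally show ?thesis .
    qed
  qed
  finally show ?thesis by simp
qed

end

lemma hellinger_sq_bounds:
  assumes "prob_space P" "prob_space Q" "sets Q = sets P" "ac_density Q P g"
  shows "0 \<le> hellinger_sq P Q" and "hellinger_sq P Q \<le> 1"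
  using integral_sq_sqrt_ac_density_le[OF assms(1-3) ac_density_deriv_ac[OF assms(4)]]
  by (auto simp: hellinger_sq_def)

text \<open>
  The constant is 8 rather than the 2 of the symmetric Hellinger distance because
  \<open>hellinger_sq\<close> ignores the part of \<open>Q\<close> that is singular to \<open>P\<close>.
\<close>

lemma sq_integral_diff_le_hellinger_sq:
  fixes U :: "'x \<Rightarrow> real"
  assumes P: "prob_space P" and Q: "prob_space Q" and sets: "sets Q = sets P"
    and ac: "ac_density Q P g"
    and [measurable]: "U \<in> borel_measurable P"
    and U: "\<And>x. x \<in> space P \<Longrightarrow> 0 \<le> U x" "\<And>x. x \<in> space P \<Longrightarrow> U x \<le> B"
  shows "((\<integral>x. U x \<partial>P) - (\<integral>x. U x \<partial>Q))\<^sup>2 \<le> 8 * B\<^sup>2 * hellinger_sq P Q"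
proof -
  interpret P: prob_space P by fact
  interpret Q: prob_space Q by fact
  note ac' = ac_density_deriv_ac[OF ac]
  define X where "X = (\<lambda>x. \<bar>sqrt (enn2real (deriv_ac Q P x)) - 1\<bar>)"
  have sp: "space Q = space P" using sets by (rule sets_eq_imp_space_eq)
  have [measurable]: "U \<in> borel_measurable Q"
    using assms(5) by (simp add: measurable_cong_sets[OF sets refl])
  have [measurable]: "deriv_ac Q P \<in> borel_measurable P" using ac' by (simp add: ac_density_def)
  obtain x0 where "x0 \<in> space P" using P.not_empty by auto
  then have B: "0 \<le> B" using U[of x0] by simp
  have iU: "integrable P U" "integrable Q U"
    using U sp by (auto intro!: P.integrable_const_bound[of _ B] Q.integrable_const_bound[of _ B])
  have "(\<integral>x. U x \<partial>P) - (\<integral>x. U x \<partial>Q) \<le> 2 * B * (\<integral>x. X x \<partial>P)"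
    unfolding X_def by (rule integral_diff_le_ac_density[OF P Q sets ac']) (use U in auto)
  \<comment> \<open>Since both measures have mass 1, applying the one-sided bound to
    \<open>B - U\<close> reverses the difference.\<close>
  moreover have "(\<integral>x. B - U x \<partial>P) - (\<integral>x. B - U x \<partial>Q) \<le> 2 * B * (\<integral>x. X x \<partial>P)"
    unfolding X_def by (rule integral_diff_le_ac_density[OF P Q sets ac']) (use U in auto)
  then have "(\<integral>x. U x \<partial>Q) - (\<integral>x. U x \<partial>P) \<le> 2 * B * (\<integral>x. X x \<partial>P)"
    using iU by (simp add: P.prob_space Q.prob_space)
  ultimately have le: "\<bar>(\<integral>x. U x \<partial>P) - (\<integral>x. U x \<partial>Q)\<bar> \<le> 2 * B * (\<integral>x. X x \<partial>P)" by linarith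
  have "((\<integral>x. U x \<partial>P) - (\<integral>x. U x \<partial>Q))\<^sup>2 \<le> (2 * B * (\<integral>x. X x \<partial>P))\<^sup>2"
    using power_mono[OF le, of 2] by simp
  also have "\<dots> = 4 * B\<^sup>2 * (\<integral>x. X x \<partial>P)\<^sup>2" by (simp add: power_mult_distrib)
  also have "\<dots> \<le> 4 * B\<^sup>2 * (\<integral>x. (X x)\<^sup>2 \<partial>P)"
  proof (intro mult_left_mono P.expectation_square_le)
    have X2: "(\<lambda>x. (X x)\<^sup>2) = (\<lambda>x. (sqrt (enn2real (deriv_ac Q P x)) - 1)\<^sup>2)"
      by (simp add: X_def)
    show "integrable P (\<lambda>x. (X x)\<^sup>2)"
      unfolding X2 by (rule integrable_sq_sqrt_ac_density[OF P Q sets ac'])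
    moreover have "X \<in> borel_measurable P"
      unfolding X_def by simp
    ultimately show "integrable P X"
      by (rule P.square_integrable_imp_integrable[rotated])
  qed simp
  also have "\<dots> = 8 * B\<^sup>2 * hellinger_sq P Q"
    by (simp add: hellinger_sq_def X_def)
  finally show ?thesis .
qed

section \<open>Value differences in Markov games\<close>

lemma prob_algebra_kernelD:
  assumes "K \<in> A \<rightarrow>\<^sub>M prob_algebra B" "x \<in> space A"
  shows "prob_space (K x)" "sets (K x) = sets B" "space (K x) = space B"
proof -
  have "K x \<in> space (prob_algebra B)" using assms by (rule measurable_space)
  then show "prob_space (K x)" "sets (K x) = sets B" "space (K x) = space B"
    by (auto simp: space_prob_algebra dest: sets_eq_imp_space_eq)
qed

lemma integral_bind_prob:
  fixes f :: "'y \<Rightarrow> real"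
  assumes M: "M \<in> space (prob_algebra A)" and K: "K \<in> A \<rightarrow>\<^sub>M prob_algebra B"
    and f: "f \<in> borel_measurable B" and bd: "\<And>x. x \<in> space B \<Longrightarrow> \<bar>f x\<bar> \<le> c"
  shows "(\<integral>x. f x \<partial>(M \<bind> K)) = (\<integral>x. (\<integral>y. f y \<partial>K x) \<partial>M)"
proof -
  interpret M: prob_space M using M by (simp add: space_prob_algebra)
  have s: "sets M = sets A" using M by (simp add: space_prob_algebra)
  have K': "K \<in> M \<rightarrow>\<^sub>M subprob_algebra B"
    using measurable_prob_algebraD[OF K] by (simp add: measurable_cong_sets[OF s refl])
  show ?thesis
  proof (rule integral_bind[OF f bd K', where B' = 1])
    show "AE x in M. emeasure (K x) (space (K x)) \<le> ennreal 1"
    proof (rule AE_I2)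
      fix x assume "x \<in> space M"
      then interpret K: prob_space "K x"
        using prob_algebra_kernelD(1)[OF K] sets_eq_imp_space_eq[OF s] by simp
      show "emeasure (K x) (space (K x)) \<le> ennreal 1" using K.emeasure_space_1 by simp
    qed
  qed (assumption | rule M.finite_measure_axioms)+
qed

lemma integral_kernel_measurable:
  fixes f :: "'y \<Rightarrow> real"
  assumes "K \<in> A \<rightarrow>\<^sub>M prob_algebra B" "f \<in> borel_measurable B"
  shows "(\<lambda>x. \<integral>y. f y \<partial>K x) \<in> borel_measurable A"
  using measurable_compose[OF measurable_prob_algebraD[OF assms(1)] integral_measurable_subprob_algebra[OF assms(2)]] .

lemma (in prob_space) integral_between:
  fixes f :: "'a \<Rightarrow> real"
  assumes f: "f \<in> borel_measurable M" and bd: "\<And>x. x \<in> space M \<Longrightarrow> a \<le> f x" "\<And>x. x \<in> space M \<Longrightarrow> f x \<le> b"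
  shows "integrable M f" "a \<le> (\<integral>x. f x \<partial>M)" "(\<integral>x. f x \<partial>M) \<le> b"
proof -
  have "norm (f x) \<le> \<bar>a\<bar> + \<bar>b\<bar>" if "x \<in> space M" for x using bd[OF that] by auto
  then show i: "integrable M f" by (intro integrable_const_bound[of _ "\<bar>a\<bar> + \<bar>b\<bar>"] f AE_I2) auto
  show "a \<le> (\<integral>x. f x \<partial>M)" using i bd(1) by (intro integral_ge_const) auto
  show "(\<integral>x. f x \<partial>M) \<le> b" using i bd(2) by (intro integral_le_const) auto
qed

section \<open>Trajectories and values under a fixed pair of policies\<close>

locale playing =
  fixes G :: "('s, 'a, 'b) game" and \<pi> :: "('s, 'a) policy" and \<nu> :: "('s, 'b) policy"
  assumes fomg: "fomg G" and policyA: "\<pi> \<in> policiesA G" and policyB: "\<nu> \<in> policiesB G"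
begin

lemma reward_measurable: "h \<in> {1..horizon G} \<Longrightarrow> reward G h \<in> borel_measurable (sab G)"
  and reward_bounds: "h \<in> {1..horizon G} \<Longrightarrow> x \<in> space (sab G) \<Longrightarrow> 0 \<le> reward G h x \<and> reward G h x \<le> 1"
  using fomg by (auto simp: fomg_def)

lemma play_kernel:
  assumes "h \<in> {1..horizon G}"
  shows "play G \<pi> \<nu> h \<in> states G \<rightarrow>\<^sub>M prob_algebra (sab G)"
proof -
  have [measurable]: "\<pi> h \<in> states G \<rightarrow>\<^sub>M prob_algebra (actA G)" "\<nu> h \<in> states G \<rightarrow>\<^sub>M prob_algebra (actB G)"
    using policyA policyB assms by (auto simp: policiesA_def policiesB_def)
  show ?thesis
    unfolding play_def[abs_def] sab_def by measurable
qed

lemma next_state_kernel: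
  assumes f: "f \<in> models G" and h: "h \<le> horizon G"
  shows "next_state G f h \<in> PiM {1..h} (\<lambda>_. sab G) \<rightarrow>\<^sub>M prob_algebra (states G)"
proof (cases "h = 0")
  case True
  have "return (states G) (init G) \<in> space (prob_algebra (states G))"
    using fomg by (auto simp: fomg_def space_prob_algebra prob_space_return)
  then show ?thesis using True by (simp add: next_state_def[abs_def])
next
  case False
  then have "f h \<in> sab G \<rightarrow>\<^sub>M prob_algebra (states G)"
    using f h by (auto simp: models_def)
  moreover have "(\<lambda>\<omega>. \<omega> h) \<in> PiM {1..h} (\<lambda>_. sab G) \<rightarrow>\<^sub>M sab G"
    using False by (intro measurable_component_singleton) auto
  ultimately show ?thesis
    using False by (simp add: next_state_def[abs_def] measurable_compose)
qed

lemma extend_measurable: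
  "(\<lambda>(\<omega>, x). fun_upd \<omega> (Suc h) x) \<in> PiM {1..h} (\<lambda>_. sab G) \<Otimes>\<^sub>M sab G \<rightarrow>\<^sub>M PiM {1..Suc h} (\<lambda>_. sab G)"
  unfolding case_prod_beta by (rule measurable_fun_upd[where J = "{1..h}"]) auto

text \<open>Joint measurability in the history and the new state is what composing with
  \<open>next_state\<close> requires in \<open>step_kernel\<close>.\<close>

lemma play_extend_kernel:
  assumes "Suc h \<le> horizon G"
  shows "(\<lambda>(\<omega>, s). play G \<pi> \<nu> (Suc h) s \<bind> (\<lambda>x. return (PiM {1..Suc h} (\<lambda>_. sab G)) (fun_upd \<omega> (Suc h) x)))
    \<in> PiM {1..h} (\<lambda>_. sab G) \<Otimes>\<^sub>M states G \<rightarrow>\<^sub>M prob_algebra (PiM {1..Suc h} (\<lambda>_. sab G))"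
proof -
  have [measurable]: "play G \<pi> \<nu> (Suc h) \<in> states G \<rightarrow>\<^sub>M prob_algebra (sab G)"
    using assms by (intro play_kernel) auto
  show ?thesis
    unfolding case_prod_beta
  proof (rule measurable_bind_prob_space2[where N = "sab G"])
    show "(\<lambda>p. play G \<pi> \<nu> (Suc h) (snd p)) \<in> PiM {1..h} (\<lambda>_. sab G) \<Otimes>\<^sub>M states G \<rightarrow>\<^sub>M prob_algebra (sab G)"
      by measurable
    have "(\<lambda>(p, x). fun_upd (fst p) (Suc h) x) \<in> (PiM {1..h} (\<lambda>_. sab G) \<Otimes>\<^sub>M states G) \<Otimes>\<^sub>M sab G \<rightarrow>\<^sub>M PiM {1..Suc h} (\<lambda>_. sab G)"
      unfolding case_prod_beta by (rule measurable_fun_upd[where J = "{1..h}"]) auto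
    from measurable_compose[OF this measurable_return_prob_space]
    show "(\<lambda>(p, x). return (PiM {1..Suc h} (\<lambda>_. sab G)) (fun_upd (fst p) (Suc h) x))
        \<in> (PiM {1..h} (\<lambda>_. sab G) \<Otimes>\<^sub>M states G) \<Otimes>\<^sub>M sab G \<rightarrow>\<^sub>M prob_algebra (PiM {1..Suc h} (\<lambda>_. sab G))"
      by (simp add: case_prod_beta)
  qed
qed

lemma step_kernel:
  assumes f: "f \<in> models G" and h: "Suc h \<le> horizon G"
  shows "(\<lambda>\<omega>. next_state G f h \<omega> \<bind> (\<lambda>s. play G \<pi> \<nu> (Suc h) s \<bind>
       (\<lambda>x. return (PiM {1..Suc h} (\<lambda>_. sab G)) (fun_upd \<omega> (Suc h) x))))
     \<in> PiM {1..h} (\<lambda>_. sab G) \<rightarrow>\<^sub>M prob_algebra (PiM {1..Suc h} (\<lambda>_. sab G))"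
  using h by (intro measurable_bind_prob_space2[OF next_state_kernel[OF f]] play_extend_kernel) auto

lemma traj_in_space:
  assumes f: "f \<in> models G"
  shows "h \<le> horizon G \<Longrightarrow> traj G f \<pi> \<nu> h \<in> space (prob_algebra (PiM {1..h} (\<lambda>_. sab G)))"
proof (induction h)
  case 0
  show ?case by (auto simp: space_prob_algebra space_PiM intro!: prob_space_return)
next
  case (Suc h)
  then have IH: "traj G f \<pi> \<nu> h \<in> space (prob_algebra (PiM {1..h} (\<lambda>_. sab G)))" by simp
  show ?case
    using prob_space_bind'[OF IH step_kernel[OF f Suc.prems]] sets_bind'[OF IH step_kernel[OF f Suc.prems]]
    by (simp add: space_prob_algebra)
qed

lemma traj_facts:
  assumes "f \<in> models G" "h \<le> horizon G"
  shows "prob_space (traj G f \<pi> \<nu> h)"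
    and "sets (traj G f \<pi> \<nu> h) = sets (PiM {1..h} (\<lambda>_. sab G))"
    and "space (traj G f \<pi> \<nu> h) = space (PiM {1..h} (\<lambda>_. sab G))"
  using traj_in_space[OF assms] by (auto simp: space_prob_algebra dest: sets_eq_imp_space_eq)

text \<open>The three binds in the last step of \<open>traj\<close> are unwound one by one; the
  bound on \<open>Y\<close> lets the Bochner integral pass through each of them.\<close>

lemma integral_traj_Suc:
  fixes Y :: "(nat \<Rightarrow> 's \<times> 'a \<times> 'b) \<Rightarrow> real"
  assumes f: "f \<in> models G" and h: "Suc h \<le> horizon G"
    and Y: "Y \<in> borel_measurable (PiM {1..Suc h} (\<lambda>_. sab G))"
    and bd: "\<And>\<omega>. \<omega> \<in> space (PiM {1..Suc h} (\<lambda>_. sab G)) \<Longrightarrow> \<bar>Y \<omega>\<bar> \<le> c"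
  shows "(\<integral>\<omega>. Y \<omega> \<partial>traj G f \<pi> \<nu> (Suc h)) =
    (\<integral>\<omega>. (\<integral>s. (\<integral>x. Y (fun_upd \<omega> (Suc h) x) \<partial>play G \<pi> \<nu> (Suc h) s) \<partial>next_state G f h \<omega>) \<partial>traj G f \<pi> \<nu> h)"
proof -
  let ?P = "\<lambda>h. PiM {1..h} (\<lambda>_. sab G)"
  have h': "h \<le> horizon G" using h by simp
  have pk: "play G \<pi> \<nu> (Suc h) \<in> states G \<rightarrow>\<^sub>M prob_algebra (sab G)"
    using h by (intro play_kernel) auto
  have "(\<integral>\<omega>. Y \<omega> \<partial>traj G f \<pi> \<nu> (Suc h)) = (\<integral>\<omega>. (\<integral>\<omega>'. Y \<omega>' \<partial>(next_state G f h \<omega> \<bind>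
      (\<lambda>s. play G \<pi> \<nu> (Suc h) s \<bind> (\<lambda>x. return (?P (Suc h)) (fun_upd \<omega> (Suc h) x))))) \<partial>traj G f \<pi> \<nu> h)"
    unfolding traj.simps by (rule integral_bind_prob[OF traj_in_space[OF f h'] step_kernel[OF f h] Y bd])
  also have "\<dots> = (\<integral>\<omega>. (\<integral>s. (\<integral>x. Y (fun_upd \<omega> (Suc h) x) \<partial>play G \<pi> \<nu> (Suc h) s) \<partial>next_state G f h \<omega>) \<partial>traj G f \<pi> \<nu> h)"
  proof (rule Bochner_Integration.integral_cong[OF refl])
    fix \<omega> assume "\<omega> \<in> space (traj G f \<pi> \<nu> h)"
    then have \<omega>: "\<omega> \<in> space (?P h)" by (simp add: traj_facts[OF f h'])
    have ns: "next_state G f h \<omega> \<in> space (prob_algebra (states G))"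
      using measurable_space[OF next_state_kernel[OF f h'] \<omega>] .
    have up: "(\<lambda>x. fun_upd \<omega> (Suc h) x) \<in> sab G \<rightarrow>\<^sub>M ?P (Suc h)"
      using measurable_compose[OF measurable_Pair1'[OF \<omega>] extend_measurable] by simp
    have ker: "(\<lambda>s. play G \<pi> \<nu> (Suc h) s \<bind> (\<lambda>x. return (?P (Suc h)) (fun_upd \<omega> (Suc h) x)))
        \<in> states G \<rightarrow>\<^sub>M prob_algebra (?P (Suc h))"
      using measurable_compose[OF measurable_Pair1'[OF \<omega>] play_extend_kernel[OF h]] by simp
    have "(\<integral>\<omega>'. Y \<omega>' \<partial>(next_state G f h \<omega> \<bind> (\<lambda>s. play G \<pi> \<nu> (Suc h) s \<bind>
        (\<lambda>x. return (?P (Suc h)) (fun_upd \<omega> (Suc h) x))))) =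
      (\<integral>s. (\<integral>\<omega>'. Y \<omega>' \<partial>(play G \<pi> \<nu> (Suc h) s \<bind> (\<lambda>x. return (?P (Suc h)) (fun_upd \<omega> (Suc h) x)))) \<partial>next_state G f h \<omega>)"
      by (rule integral_bind_prob[OF ns ker Y bd])
    also have "\<dots> = (\<integral>s. (\<integral>x. Y (fun_upd \<omega> (Suc h) x) \<partial>play G \<pi> \<nu> (Suc h) s) \<partial>next_state G f h \<omega>)"
    proof (rule Bochner_Integration.integral_cong[OF refl])
      fix s assume "s \<in> space (next_state G f h \<omega>)"
      then have s: "s \<in> space (states G)"
        using ns by (auto simp: space_prob_algebra dest: sets_eq_imp_space_eq)
      have pl: "play G \<pi> \<nu> (Suc h) s \<in> space (prob_algebra (sab G))"
        using measurable_space[OF pk s] .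
      have "(\<integral>\<omega>'. Y \<omega>' \<partial>(play G \<pi> \<nu> (Suc h) s \<bind> (\<lambda>x. return (?P (Suc h)) (fun_upd \<omega> (Suc h) x)))) =
        (\<integral>x. (\<integral>\<omega>'. Y \<omega>' \<partial>return (?P (Suc h)) (fun_upd \<omega> (Suc h) x)) \<partial>play G \<pi> \<nu> (Suc h) s)"
        by (rule integral_bind_prob[OF pl measurable_compose[OF up measurable_return_prob_space] Y bd])
      also have "\<dots> = (\<integral>x. Y (fun_upd \<omega> (Suc h) x) \<partial>play G \<pi> \<nu> (Suc h) s)"
      proof (rule Bochner_Integration.integral_cong[OF refl])
        fix x assume "x \<in> space (play G \<pi> \<nu> (Suc h) s)"
        then have "x \<in> space (sab G)" using prob_algebra_kernelD(3)[OF pk s] by simp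
        then show "(\<integral>\<omega>'. Y \<omega>' \<partial>return (?P (Suc h)) (fun_upd \<omega> (Suc h) x)) = Y (fun_upd \<omega> (Suc h) x)"
          by (intro integral_return measurable_space[OF up] Y)
      qed
      finally show "(\<integral>\<omega>'. Y \<omega>' \<partial>(play G \<pi> \<nu> (Suc h) s \<bind> (\<lambda>x. return (?P (Suc h)) (fun_upd \<omega> (Suc h) x)))) =
        (\<integral>x. Y (fun_upd \<omega> (Suc h) x) \<partial>play G \<pi> \<nu> (Suc h) s)" .
    qed
    finally show "(\<integral>\<omega>'. Y \<omega>' \<partial>(next_state G f h \<omega> \<bind> (\<lambda>s. play G \<pi> \<nu> (Suc h) s \<bind>
        (\<lambda>x. return (?P (Suc h)) (fun_upd \<omega> (Suc h) x))))) =
      (\<integral>s. (\<integral>x. Y (fun_upd \<omega> (Suc h) x) \<partial>play G \<pi> \<nu> (Suc h) s) \<partial>next_state G f h \<omega>)" .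
  qed
  finally show ?thesis .
qed

text \<open>The second argument counts the remaining steps, so \<open>value_to_go f n\<close> starts at step \<open>H - n + 1\<close>.\<close>

primrec value_to_go :: "('s, 'a, 'b) model \<Rightarrow> nat \<Rightarrow> 's \<Rightarrow> real" where
  "value_to_go f 0 = (\<lambda>s. 0)"
| "value_to_go f (Suc n) = (\<lambda>s. \<integral>x. reward G (horizon G - n) x +
     (\<integral>s'. value_to_go f n s' \<partial>f (horizon G - n) x) \<partial>play G \<pi> \<nu> (horizon G - n) s)"

lemma model_kernel: "f \<in> models G \<Longrightarrow> h \<in> {1..horizon G} \<Longrightarrow> f h \<in> sab G \<rightarrow>\<^sub>M prob_algebra (states G)"
  by (simp add: models_def)

text \<open>Measurability and bounds share one induction, since bounding the integral in the
  recursion uses measurability of the previous stage.\<close>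

lemma value_to_go_facts:
  assumes f: "f \<in> models G"
  shows "n \<le> horizon G \<Longrightarrow> value_to_go f n \<in> borel_measurable (states G) \<and>
    (\<forall>s\<in>space (states G). 0 \<le> value_to_go f n s \<and> value_to_go f n s \<le> real n)"
proof (induction n)
  case 0
  then show ?case by simp
next
  case (Suc n)
  let ?h = "horizon G - n"
  have h: "?h \<in> {1..horizon G}" using Suc.prems by auto
  have m: "value_to_go f n \<in> borel_measurable (states G)"
    and b: "\<And>s. s \<in> space (states G) \<Longrightarrow> 0 \<le> value_to_go f n s"
      "\<And>s. s \<in> space (states G) \<Longrightarrow> value_to_go f n s \<le> real n"
    using Suc by auto
  let ?q = "\<lambda>x. reward G ?h x + (\<integral>s'. value_to_go f n s' \<partial>f ?h x)"
  have q: "?q \<in> borel_measurable (sab G)"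
    using reward_measurable[OF h] integral_kernel_measurable[OF model_kernel[OF f h] m] by simp
  have qb: "0 \<le> ?q x \<and> ?q x \<le> real (Suc n)" if x: "x \<in> space (sab G)" for x
  proof -
    note k = prob_algebra_kernelD[OF model_kernel[OF f h] x]
    interpret k: prob_space "f ?h x" by (rule k)
    have "value_to_go f n \<in> borel_measurable (f ?h x)"
      using m by (simp add: measurable_cong_sets[OF k(2) refl])
    from k.integral_between(2,3)[OF this, of 0 "real n"] b reward_bounds[OF h x] k(3)
    show ?thesis by simp
  qed
  have "0 \<le> value_to_go f (Suc n) s \<and> value_to_go f (Suc n) s \<le> real (Suc n)" if s: "s \<in> space (states G)" for s
  proof -
    note p = prob_algebra_kernelD[OF play_kernel[OF h] s]
    interpret p: prob_space "play G \<pi> \<nu> ?h s" by (rule p)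
    have "?q \<in> borel_measurable (play G \<pi> \<nu> ?h s)"
      using q by (simp add: measurable_cong_sets[OF p(2) refl])
    from p.integral_between(2,3)[OF this, of 0 "real (Suc n)"] qb p(3)
    show ?thesis by simp
  qed
  then show ?case
    using integral_kernel_measurable[OF play_kernel[OF h] q] by simp
qed

text \<open>
  The return of playing \<open>h\<close> steps in \<open>g\<close>, drawing the next state from \<open>k\<close> and finishing in
  \<open>f\<close>.  Passing from \<open>h\<close> to \<open>h + 1\<close> swaps one transition of \<open>f\<close> for one of \<open>g\<close>, so the value
  difference telescopes into one-step errors along trajectories of \<open>g\<close>.
\<close>

definition hybrid :: "('s, 'a, 'b) model \<Rightarrow> ('s, 'a, 'b) model \<Rightarrow> ('s, 'a, 'b) model \<Rightarrow> nat \<Rightarrow> real" where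
  "hybrid g f k h = (\<integral>\<omega>. (\<Sum>i=1..h. reward G i (\<omega> i)) +
     (\<integral>s. value_to_go f (horizon G - h) s \<partial>next_state G k h \<omega>) \<partial>traj G g \<pi> \<nu> h)"

lemma hybrid_integrand:
  assumes f: "f \<in> models G" and k: "k \<in> models G" and h: "h \<le> horizon G"
  shows "(\<lambda>\<omega>. \<Sum>i=1..h. reward G i (\<omega> i)) \<in> borel_measurable (PiM {1..h} (\<lambda>_. sab G))"
    and "(\<lambda>\<omega>. \<integral>s. value_to_go f (horizon G - h) s \<partial>next_state G k h \<omega>) \<in> borel_measurable (PiM {1..h} (\<lambda>_. sab G))"
    and "\<omega> \<in> space (PiM {1..h} (\<lambda>_. sab G)) \<Longrightarrow> 0 \<le> (\<Sum>i=1..h. reward G i (\<omega> i)) \<and> (\<Sum>i=1..h. reward G i (\<omega> i)) \<le> real h"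
    and "\<omega> \<in> space (PiM {1..h} (\<lambda>_. sab G)) \<Longrightarrow> 0 \<le> (\<integral>s. value_to_go f (horizon G - h) s \<partial>next_state G k h \<omega>) \<and>
       (\<integral>s. value_to_go f (horizon G - h) s \<partial>next_state G k h \<omega>) \<le> real (horizon G)"
proof -
  note V = value_to_go_facts[OF f, of "horizon G - h"]
  show "(\<lambda>\<omega>. \<Sum>i=1..h. reward G i (\<omega> i)) \<in> borel_measurable (PiM {1..h} (\<lambda>_. sab G))"
  proof (rule borel_measurable_sum)
    fix i assume i: "i \<in> {1..h}"
    then have "reward G i \<in> borel_measurable (sab G)" using h by (intro reward_measurable) auto
    with measurable_component_singleton[OF i, of "\<lambda>_. sab G"]
    show "(\<lambda>\<omega>. reward G i (\<omega> i)) \<in> borel_measurable (PiM {1..h} (\<lambda>_. sab G))"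
      by (rule measurable_compose)
  qed
  show "(\<lambda>\<omega>. \<integral>s. value_to_go f (horizon G - h) s \<partial>next_state G k h \<omega>) \<in> borel_measurable (PiM {1..h} (\<lambda>_. sab G))"
    using V by (intro integral_kernel_measurable[OF next_state_kernel[OF k h]]) auto
  assume \<omega>: "\<omega> \<in> space (PiM {1..h} (\<lambda>_. sab G))"
  have "0 \<le> reward G i (\<omega> i) \<and> reward G i (\<omega> i) \<le> 1" if "i \<in> {1..h}" for i
    using that h \<omega> by (intro reward_bounds) (auto simp: space_PiM)
  then show "0 \<le> (\<Sum>i=1..h. reward G i (\<omega> i)) \<and> (\<Sum>i=1..h. reward G i (\<omega> i)) \<le> real h"
    using sum_bounded_above[of "{1..h}" "\<lambda>i. reward G i (\<omega> i)" 1]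
      sum_nonneg[of "{1..h}" "\<lambda>i. reward G i (\<omega> i)"] by simp
  note n = prob_algebra_kernelD[OF next_state_kernel[OF k h] \<omega>]
  interpret n: prob_space "next_state G k h \<omega>" by (rule n)
  have "value_to_go f (horizon G - h) \<in> borel_measurable (next_state G k h \<omega>)"
    using V by (simp add: measurable_cong_sets[OF n(2) refl])
  moreover have "value_to_go f (horizon G - h) s \<le> real (horizon G)" if "s \<in> space (states G)" for s
  proof -
    have "value_to_go f (horizon G - h) s \<le> real (horizon G - h)" using V that by simp
    also have "\<dots> \<le> real (horizon G)" by simp
    finally show ?thesis .
  qed
  ultimately show "0 \<le> (\<integral>s. value_to_go f (horizon G - h) s \<partial>next_state G k h \<omega>) \<and>
       (\<integral>s. value_to_go f (horizon G - h) s \<partial>next_state G k h \<omega>) \<le> real (horizon G)"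
    using V n(3) n.integral_between(2,3)[of "value_to_go f (horizon G - h)" 0 "real (horizon G)"] by simp
qed

text \<open>Both sides draw step \<open>h + 1\<close> from \<open>g\<close> and then continue in
  \<open>f\<close>. The left side records that step in the trajectory; the right side contains it as
  the first unfolding of \<open>value_to_go\<close>.\<close>

lemma hybrid_Suc:
  assumes g: "g \<in> models G" and f: "f \<in> models G" and h: "Suc h \<le> horizon G"
  shows "hybrid g f f (Suc h) = hybrid g f g h"
proof -
  let ?n = "horizon G - Suc h"
  \<comment> \<open>With \<open>?n\<close> steps left after step \<open>h + 1\<close>, the recursion
    for \<open>Suc ?n\<close> uses exactly the index \<open>h + 1\<close>.\<close>
  have n: "horizon G - h = Suc ?n" "horizon G - ?n = Suc h" using h by auto
  have h': "h \<le> horizon G" "Suc h \<in> {1..horizon G}" "?n \<le> horizon G" using h by auto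
  let ?Y = "\<lambda>\<omega>. (\<Sum>i=1..Suc h. reward G i (\<omega> i)) + (\<integral>s. value_to_go f ?n s \<partial>next_state G f (Suc h) \<omega>)"
  let ?q = "\<lambda>x. reward G (Suc h) x + (\<integral>s'. value_to_go f ?n s' \<partial>f (Suc h) x)"
  note I = hybrid_integrand[OF f f h]
  note V = value_to_go_facts[OF f h'(3)]
  have "hybrid g f f (Suc h) = (\<integral>\<omega>. (\<integral>s. (\<integral>x. ?Y (fun_upd \<omega> (Suc h) x) \<partial>play G \<pi> \<nu> (Suc h) s) \<partial>next_state G g h \<omega>) \<partial>traj G g \<pi> \<nu> h)"
    unfolding hybrid_def
  proof (rule integral_traj_Suc[OF g h])
    show "?Y \<in> borel_measurable (PiM {1..Suc h} (\<lambda>_. sab G))"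
      by (rule borel_measurable_add[OF I(1,2)])
    show "\<bar>?Y \<omega>\<bar> \<le> real (Suc h) + real (horizon G)" if "\<omega> \<in> space (PiM {1..Suc h} (\<lambda>_. sab G))" for \<omega>
      using I(3,4)[OF that] by linarith
  qed
  also have "\<dots> = hybrid g f g h"
    unfolding hybrid_def
  proof (rule Bochner_Integration.integral_cong[OF refl])
    fix \<omega> assume "\<omega> \<in> space (traj G g \<pi> \<nu> h)"
    then have \<omega>: "\<omega> \<in> space (PiM {1..h} (\<lambda>_. sab G))" by (simp add: traj_facts[OF g h'(1)])
    let ?R = "\<Sum>i=1..h. reward G i (\<omega> i)"
    note ns = prob_algebra_kernelD[OF next_state_kernel[OF g h'(1)] \<omega>]
    interpret ns: prob_space "next_state G g h \<omega>" by (rule ns)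
    have "(\<integral>s. (\<integral>x. ?Y (fun_upd \<omega> (Suc h) x) \<partial>play G \<pi> \<nu> (Suc h) s) \<partial>next_state G g h \<omega>) =
      (\<integral>s. ?R + value_to_go f (Suc ?n) s \<partial>next_state G g h \<omega>)"
    proof (rule Bochner_Integration.integral_cong[OF refl])
      fix s assume "s \<in> space (next_state G g h \<omega>)"
      then have s: "s \<in> space (states G)" by (simp add: ns)
      note p = prob_algebra_kernelD[OF play_kernel[OF h'(2)] s]
      interpret p: prob_space "play G \<pi> \<nu> (Suc h) s" by (rule p)
      \<comment> \<open>The update leaves the earlier rewards alone, and the transition after a
        positive step reads only the last component.\<close>
      have Y: "?Y (fun_upd \<omega> (Suc h) x) = ?R + ?q x" for x
        by (simp add: next_state_def)
      have q: "integrable (play G \<pi> \<nu> (Suc h) s) ?q"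
      proof (rule p.integral_between(1))
        have "?q \<in> borel_measurable (sab G)"
          using V by (intro borel_measurable_add reward_measurable[OF h'(2)]
              integral_kernel_measurable[OF model_kernel[OF f h'(2)]]) auto
        then show "?q \<in> borel_measurable (play G \<pi> \<nu> (Suc h) s)"
          by (simp add: measurable_cong_sets[OF p(2) refl])
        fix x assume "x \<in> space (play G \<pi> \<nu> (Suc h) s)"
        then have x: "x \<in> space (sab G)" by (simp add: p)
        note k = prob_algebra_kernelD[OF model_kernel[OF f h'(2)] x]
        interpret k: prob_space "f (Suc h) x" by (rule k)
        have "value_to_go f ?n \<in> borel_measurable (f (Suc h) x)"
          using V by (simp add: measurable_cong_sets[OF k(2) refl])
        from k.integral_between(2,3)[OF this, of 0 "real ?n"] V k(3)
        have "0 \<le> (\<integral>s'. value_to_go f ?n s' \<partial>f (Suc h) x)" "(\<integral>s'. value_to_go f ?n s' \<partial>f (Suc h) x) \<le> real ?n"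
          by simp_all
        with reward_bounds[OF h'(2) x] show "0 \<le> ?q x" "?q x \<le> 1 + real ?n" by linarith+
      qed
      have "(\<integral>x. ?R + ?q x \<partial>play G \<pi> \<nu> (Suc h) s) = ?R + (\<integral>x. ?q x \<partial>play G \<pi> \<nu> (Suc h) s)"
        using q by (subst Bochner_Integration.integral_add) (auto simp: p.prob_space)
      then show "(\<integral>x. ?Y (fun_upd \<omega> (Suc h) x) \<partial>play G \<pi> \<nu> (Suc h) s) = ?R + value_to_go f (Suc ?n) s"
        unfolding Y by (simp add: n)
    qed
    also have "\<dots> = ?R + (\<integral>s. value_to_go f (Suc ?n) s \<partial>next_state G g h \<omega>)"
    proof -
      have V': "value_to_go f (Suc ?n) \<in> borel_measurable (states G) \<and>
          (\<forall>s\<in>space (states G). 0 \<le> value_to_go f (Suc ?n) s \<and> value_to_go f (Suc ?n) s \<le> real (Suc ?n))"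
        using h by (intro value_to_go_facts[OF f]) auto
      have "integrable (next_state G g h \<omega>) (value_to_go f (Suc ?n))"
        using V' by (intro ns.integral_between(1)[of _ 0 "real (Suc ?n)"])
          (auto simp: measurable_cong_sets[OF ns(2) refl] ns(3) simp del: value_to_go.simps)
      then show ?thesis
        by (subst Bochner_Integration.integral_add) (auto simp: ns.prob_space)
    qed
    finally show "(\<integral>s. (\<integral>x. ?Y (fun_upd \<omega> (Suc h) x) \<partial>play G \<pi> \<nu> (Suc h) s) \<partial>next_state G g h \<omega>) =
      ?R + (\<integral>s. value_to_go f (horizon G - h) s \<partial>next_state G g h \<omega>)"
      by (simp only: n)
  qed
  finally show ?thesis .
qed

lemma hybrid_horizon: "hybrid g f k (horizon G) = val G g \<pi> \<nu>"
  by (simp add: hybrid_def val_def)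

text \<open>The chain of hybrids starts at the value of \<open>f\<close>, because trajectories of
  length 0 are the same in every model, and ends at the value of \<open>g\<close>, because no reward
  is left after the horizon.\<close>

lemma value_difference:
  assumes g: "g \<in> models G" and f: "f \<in> models G"
  shows "val G f \<pi> \<nu> - val G g \<pi> \<nu> =
    (\<Sum>h=1..horizon G. \<integral>\<omega>. (\<integral>s. value_to_go f (horizon G - h) s \<partial>f h (\<omega> h)) -
       (\<integral>s. value_to_go f (horizon G - h) s \<partial>g h (\<omega> h)) \<partial>traj G g \<pi> \<nu> h)"
proof -
  have diff: "hybrid g f f h - hybrid g f g h =
    (\<integral>\<omega>. (\<integral>s. value_to_go f (horizon G - h) s \<partial>f h (\<omega> h)) -
       (\<integral>s. value_to_go f (horizon G - h) s \<partial>g h (\<omega> h)) \<partial>traj G g \<pi> \<nu> h)" if "h \<in> {1..horizon G}" for h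
  proof -
    have h: "h \<le> horizon G" "h \<noteq> 0" using that by auto
    interpret t: prob_space "traj G g \<pi> \<nu> h" by (rule traj_facts[OF g h(1)])
    note t = traj_facts[OF g h(1)]
    have mt: "Y \<in> borel_measurable (traj G g \<pi> \<nu> h)" if "Y \<in> borel_measurable (PiM {1..h} (\<lambda>_. sab G))"
      for Y :: "_ \<Rightarrow> real"
      using that by (simp add: measurable_cong_sets[OF t(2) refl])
    have i: "integrable (traj G g \<pi> \<nu> h) (\<lambda>\<omega>. \<Sum>i=1..h. reward G i (\<omega> i))"
      by (rule t.integral_between(1)[OF mt[OF hybrid_integrand(1)[OF f g h(1)]], of 0 "real h"])
        (simp_all only: t(3) hybrid_integrand(3)[OF f g h(1)])
    have iV: "integrable (traj G g \<pi> \<nu> h) (\<lambda>\<omega>. \<integral>s. value_to_go f (horizon G - h) s \<partial>next_state G k h \<omega>)"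
      if k: "k \<in> models G" for k
      by (rule t.integral_between(1)[OF mt[OF hybrid_integrand(2)[OF f k h(1)]], of 0 "real (horizon G)"])
        (simp_all only: t(3) hybrid_integrand(4)[OF f k h(1)])
    have ns: "next_state G k h \<omega> = k h (\<omega> h)" for k :: "('s, 'a, 'b) model" and \<omega>
      using h(2) by (simp add: next_state_def)
    show ?thesis
      unfolding hybrid_def Bochner_Integration.integral_add[OF i iV[OF f]]
        Bochner_Integration.integral_add[OF i iV[OF g]] add_diff_cancel_left
        Bochner_Integration.integral_diff[OF iV[OF f] iV[OF g], symmetric]
      unfolding ns ..
  qed
  have step: "hybrid g f f n = hybrid g f f 0 - (\<Sum>h<n. hybrid g f f h - hybrid g f g h)" if "n \<le> horizon G" for n
    using that by (induction n) (auto simp: hybrid_Suc[OF g f])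
  have "hybrid f f f n = hybrid f f f 0" if "n \<le> horizon G" for n
    using that by (induction n) (auto simp: hybrid_Suc[OF f f])
  from this[of "horizon G"] have "val G f \<pi> \<nu> = hybrid f f f 0"
    by (simp add: hybrid_horizon)
  also have "\<dots> = hybrid g f f 0" by (simp add: hybrid_def)
  finally have "val G f \<pi> \<nu> - val G g \<pi> \<nu> = (\<Sum>h<horizon G. hybrid g f f h - hybrid g f g h)"
    using step[of "horizon G"] by (simp add: hybrid_horizon)
  \<comment> \<open>The ranges differ only in \<open>h = 0\<close> and \<open>h = horizon G\<close>.
    At 0 the next state is the fixed initial state in both models; at the horizon the remaining
    value is 0. Both differences vanish.\<close>
  also have "\<dots> = (\<Sum>h=1..horizon G. hybrid g f f h - hybrid g f g h)"
  proof (rule sum.mono_neutral_cong)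
    show "hybrid g f f h - hybrid g f g h = 0" if "h \<in> {..<horizon G} - {1..horizon G}" for h
    proof -
      have "h = 0" using that by auto
      then show ?thesis by (simp add: hybrid_def next_state_def)
    qed
    show "hybrid g f f h - hybrid g f g h = 0" if "h \<in> {1..horizon G} - {..<horizon G}" for h
    proof -
      have "h = horizon G" using that by auto
      then show ?thesis by (simp add: hybrid_horizon)
    qed
  qed simp_all
  finally show ?thesis using diff by simp
qed

end

section \<open>Linear Markov games\<close>

text \<open>Averages a pointwise bound by Jensen's inequality, so that the potential argument can
  use the deterministic mean features in place of random ones.\<close>

lemma (in playing) sq_expectation_feature_le:
  fixes \<psi> :: "'s \<times> 'a \<times> 'b \<Rightarrow> real ^ 'd" and u :: "'s \<times> 'a \<times> 'b \<Rightarrow> real"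
  assumes g: "g \<in> models G" and h: "h \<in> {1..horizon G}"
    and \<psi>: "\<psi> \<in> borel_measurable (sab G)" "\<And>x. x \<in> space (sab G) \<Longrightarrow> norm (\<psi> x) \<le> 1"
    and u: "u \<in> borel_measurable (sab G)" "\<And>x. x \<in> space (sab G) \<Longrightarrow> 0 \<le> u x" "\<And>x. x \<in> space (sab G) \<Longrightarrow> u x \<le> 1"
  defines "\<mu> \<equiv> \<integral>\<omega>. \<psi> (\<omega> h) \<partial>traj G g \<pi> \<nu> h"
  shows "norm \<mu> \<le> 1"
    and "(\<integral>\<omega>. v \<bullet> \<psi> (\<omega> h) \<partial>traj G g \<pi> \<nu> h) = v \<bullet> \<mu>"
    and "0 \<le> data_expectation G g \<pi> \<nu> h u" "data_expectation G g \<pi> \<nu> h u \<le> 1"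
    and "(\<And>x. x \<in> space (sab G) \<Longrightarrow> (v \<bullet> \<psi> x)\<^sup>2 \<le> c * u x) \<Longrightarrow>
      (v \<bullet> \<mu>)\<^sup>2 \<le> c * data_expectation G g \<pi> \<nu> h u"
proof -
  have h': "h \<le> horizon G" "h \<in> {1..h}" using h by auto
  note t = traj_facts[OF g h'(1)]
  interpret t: prob_space "traj G g \<pi> \<nu> h" by (rule t)
  have comp: "(\<lambda>\<omega>. \<omega> h) \<in> traj G g \<pi> \<nu> h \<rightarrow>\<^sub>M sab G"
    using measurable_component_singleton[OF h'(2), of "\<lambda>_. sab G"]
    by (simp add: measurable_cong_sets[OF t(2) refl])
  note sp = measurable_space[OF comp]
  note m = measurable_compose[OF comp \<psi>(1)] measurable_compose[OF comp u(1)]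
  have i: "integrable (traj G g \<pi> \<nu> h) (\<lambda>\<omega>. \<psi> (\<omega> h))"
    using \<psi>(2)[OF sp] by (intro t.integrable_const_bound[of _ 1] m(1) AE_I2)
  have "norm \<mu> \<le> (\<integral>\<omega>. norm (\<psi> (\<omega> h)) \<partial>traj G g \<pi> \<nu> h)"
    unfolding \<mu>_def by (rule integral_norm_bound)
  also have "\<dots> \<le> 1"
    using \<psi>(2)[OF sp] by (intro t.integral_le_const integrable_norm[OF i] AE_I2)
  finally show "norm \<mu> \<le> 1" .
  show mean: "(\<integral>\<omega>. v \<bullet> \<psi> (\<omega> h) \<partial>traj G g \<pi> \<nu> h) = v \<bullet> \<mu>"
    unfolding \<mu>_def using i by (rule integral_inner_right)
  show "0 \<le> data_expectation G g \<pi> \<nu> h u" "data_expectation G g \<pi> \<nu> h u \<le> 1"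
    unfolding data_expectation_def
    using t.integral_between(2,3)[OF m(2), of 0 1] u(2,3)[OF sp] by auto
  assume le: "\<And>x. x \<in> space (sab G) \<Longrightarrow> (v \<bullet> \<psi> x)\<^sup>2 \<le> c * u x"
  have iu: "integrable (traj G g \<pi> \<nu> h) (\<lambda>\<omega>. u (\<omega> h))"
    using t.integral_between(1)[OF m(2), of 0 1] u(2,3)[OF sp] by auto
  have i2: "integrable (traj G g \<pi> \<nu> h) (\<lambda>\<omega>. (v \<bullet> \<psi> (\<omega> h))\<^sup>2)"
  proof (rule Bochner_Integration.integrable_bound)
    show "integrable (traj G g \<pi> \<nu> h) (\<lambda>\<omega>. c * u (\<omega> h))" using iu by simp
    show "(\<lambda>\<omega>. (v \<bullet> \<psi> (\<omega> h))\<^sup>2) \<in> borel_measurable (traj G g \<pi> \<nu> h)"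
      using m(1) by measurable
    show "AE \<omega> in traj G g \<pi> \<nu> h. norm ((v \<bullet> \<psi> (\<omega> h))\<^sup>2) \<le> norm (c * u (\<omega> h))"
    proof (rule AE_I2)
      fix \<omega> assume "\<omega> \<in> space (traj G g \<pi> \<nu> h)"
      from order_trans[OF le[OF sp[OF this]] abs_ge_self]
      show "norm ((v \<bullet> \<psi> (\<omega> h))\<^sup>2) \<le> norm (c * u (\<omega> h))" by simp
    qed
  qed
  have "(v \<bullet> \<mu>)\<^sup>2 \<le> (\<integral>\<omega>. (v \<bullet> \<psi> (\<omega> h))\<^sup>2 \<partial>traj G g \<pi> \<nu> h)"
    unfolding mean[symmetric] using i i2 by (intro t.expectation_square_le) auto
  also have "\<dots> \<le> (\<integral>\<omega>. c * u (\<omega> h) \<partial>traj G g \<pi> \<nu> h)"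
    using i2 iu le[OF sp] by (intro Bochner_Integration.integral_mono) auto
  finally show "(v \<bullet> \<mu>)\<^sup>2 \<le> c * data_expectation G g \<pi> \<nu> h u"
    by (simp add: data_expectation_def)
qed

text \<open>Supplies the vector that represents integration of \<open>U\<close> against a linear
  transition kernel.\<close>

lemma integral_scaleR_bounded:
  fixes \<theta> :: "'x \<Rightarrow> 'v::euclidean_space"
  assumes [measurable]: "\<theta> \<in> borel_measurable M" "U \<in> borel_measurable M"
    and \<theta>: "(\<integral>\<^sup>+ s. ennreal (norm (\<theta> s)) \<partial>M) \<le> ennreal c" and "0 \<le> B" "0 \<le> c"
    and U: "\<And>s. s \<in> space M \<Longrightarrow> \<bar>U s\<bar> \<le> B"
  shows "integrable M (\<lambda>s. U s *\<^sub>R \<theta> s)" and "norm (\<integral>s. U s *\<^sub>R \<theta> s \<partial>M) \<le> B * c"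
proof -
  have "(\<integral>\<^sup>+ s. ennreal (norm (U s *\<^sub>R \<theta> s)) \<partial>M) \<le> (\<integral>\<^sup>+ s. ennreal B * ennreal (norm (\<theta> s)) \<partial>M)"
    using U \<open>0 \<le> B\<close> by (intro nn_integral_mono) (auto simp: ennreal_mult'[symmetric] intro!: mult_right_mono)
  also have "\<dots> = ennreal B * (\<integral>\<^sup>+ s. ennreal (norm (\<theta> s)) \<partial>M)"
    by (simp add: nn_integral_cmult)
  also have "\<dots> \<le> ennreal B * ennreal c"
    using \<theta> by (intro mult_left_mono) auto
  finally have le: "(\<integral>\<^sup>+ s. ennreal (norm (U s *\<^sub>R \<theta> s)) \<partial>M) \<le> ennreal (B * c)"
    using \<open>0 \<le> B\<close> by (simp add: ennreal_mult')
  then show i: "integrable M (\<lambda>s. U s *\<^sub>R \<theta> s)"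
    by (intro integrableI_bounded) (auto simp: le_less_trans)
  have "ennreal (norm (\<integral>s. U s *\<^sub>R \<theta> s \<partial>M)) \<le> ennreal (B * c)"
    using integral_norm_bound_ennreal[OF i] le by (rule order_trans)
  then show "norm (\<integral>s. U s *\<^sub>R \<theta> s \<partial>M) \<le> B * c"
    using \<open>0 \<le> B\<close> \<open>0 \<le> c\<close> by simp
qed

text \<open>Separates the part that goes into \<open>2 * H * sqrt (D * H * T)\<close> from the part
  with the losses. Cauchy-Schwarz on the latter costs a factor \<open>H\<close>, the third one in
  the GEC constant.\<close>

lemma sum_sqrt_add_le:
  fixes E :: "nat \<Rightarrow> real"
  assumes "\<And>h. h \<in> {1..H} \<Longrightarrow> 0 \<le> E h" "0 \<le> a" "0 \<le> b"
  shows "(\<Sum>h=1..H. sqrt (a + b * E h)) \<le> real H * sqrt a + sqrt (b * real H * (\<Sum>h=1..H. E h))"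
proof -
  have "(\<Sum>h=1..H. sqrt (a + b * E h)) \<le> (\<Sum>h=1..H. sqrt a + sqrt (b * E h))"
    using assms by (intro sum_mono sqrt_add_le_add_sqrt) auto
  also have "\<dots> = real H * sqrt a + (\<Sum>h=1..H. sqrt (b * E h) * 1)"
    by (simp add: sum.distrib)
  also have "(\<Sum>h=1..H. sqrt (b * E h) * 1) \<le> sqrt (b * real H * (\<Sum>h=1..H. E h))"
  proof (rule real_le_rsqrt)
    have "(\<Sum>h=1..H. sqrt (b * E h) * 1)\<^sup>2 \<le> (\<Sum>h=1..H. (sqrt (b * E h))\<^sup>2) * (\<Sum>h=1..H. 1\<^sup>2)"
      by (rule Cauchy_Schwarz_ineq_sum)
    also have "(\<Sum>h=1..H. (sqrt (b * E h))\<^sup>2) = (\<Sum>h=1..H. b * E h)"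
      using assms by (intro sum.cong) auto
    finally show "(\<Sum>h=1..H. sqrt (b * E h) * 1)\<^sup>2 \<le> b * real H * (\<Sum>h=1..H. E h)"
      by (simp add: sum_distrib_left[symmetric] mult_ac)
  qed
  finally show ?thesis by simp
qed

section \<open>Linear models: one-step errors and Hellinger loss\<close>

context
  fixes G :: "('s, 'a, 'b) game" and \<phi> :: "'s \<times> 'a \<times> 'b \<Rightarrow> real ^ 'd"
    and F :: "('s, 'a, 'b) model set" and fs :: "('s, 'a, 'b) model"
  assumes linear: "linear_mg G \<phi> F fs"
begin

lemma linear_mg_facts:
  shows "fomg G" "F \<subseteq> models G" "fs \<in> F" "\<phi> \<in> borel_measurable (sab G)"
    "x \<in> space (sab G) \<Longrightarrow> norm (\<phi> x) \<le> 1"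
  using linear by (auto simp: linear_mg_def)

lemma linear_model_density:
  assumes "f \<in> F" "h \<in> {1..horizon G}"
  obtains \<theta> where "\<theta> \<in> borel_measurable (states G)"
    "(\<integral>\<^sup>+ s. ennreal (norm (\<theta> s)) \<partial>states G) \<le> ennreal (sqrt CARD('d))"
    "\<And>x. x \<in> space (sab G) \<Longrightarrow> AE s in states G. 0 \<le> \<theta> s \<bullet> \<phi> x"
    "\<And>x. x \<in> space (sab G) \<Longrightarrow> f h x = density (states G) (\<lambda>s. ennreal (\<theta> s \<bullet> \<phi> x))"
  using linear assms unfolding linear_mg_def by blast

lemma linear_model_integral:
  fixes U :: "'s \<Rightarrow> real"
  assumes f: "f \<in> F" and h: "h \<in> {1..horizon G}"
    and U: "U \<in> borel_measurable (states G)" "\<And>s. s \<in> space (states G) \<Longrightarrow> \<bar>U s\<bar> \<le> B" and B: "0 \<le> B"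
  obtains v where "norm v \<le> B * sqrt CARD('d)"
    "\<And>x. x \<in> space (sab G) \<Longrightarrow> (\<integral>s. U s \<partial>f h x) = v \<bullet> \<phi> x"
proof -
  obtain \<theta> where \<theta>: "\<theta> \<in> borel_measurable (states G)"
    "(\<integral>\<^sup>+ s. ennreal (norm (\<theta> s)) \<partial>states G) \<le> ennreal (sqrt CARD('d))"
    "\<And>x. x \<in> space (sab G) \<Longrightarrow> AE s in states G. 0 \<le> \<theta> s \<bullet> \<phi> x"
    "\<And>x. x \<in> space (sab G) \<Longrightarrow> f h x = density (states G) (\<lambda>s. ennreal (\<theta> s \<bullet> \<phi> x))"
    using linear_model_density[OF f h] by blast
  note i = integral_scaleR_bounded[OF \<theta>(1) U(1) \<theta>(2) B _ U(2)]
  show ?thesis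
  proof (rule that)
    show "norm (\<integral>s. U s *\<^sub>R \<theta> s \<partial>states G) \<le> B * sqrt CARD('d)"
      by (rule i(2)) simp_all
    fix x assume x: "x \<in> space (sab G)"
    have "(\<integral>s. U s \<partial>f h x) = (\<integral>s. (\<theta> s \<bullet> \<phi> x) *\<^sub>R U s \<partial>states G)"
      unfolding \<theta>(4)[OF x] using \<theta>(1) U(1) by (intro integral_density \<theta>(3)[OF x]) auto
    also have "\<dots> = (\<integral>s. (U s *\<^sub>R \<theta> s) \<bullet> \<phi> x \<partial>states G)"
      by (simp add: mult.commute)
    also have "\<dots> = (\<integral>s. U s *\<^sub>R \<theta> s \<partial>states G) \<bullet> \<phi> x"
      by (rule integral_inner_left) (rule i(1), simp_all)
    finally show "(\<integral>s. U s \<partial>f h x) = (\<integral>s. U s *\<^sub>R \<theta> s \<partial>states G) \<bullet> \<phi> x" .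
  qed
qed

lemma linear_model_prob_space:
  assumes "f \<in> F" "h \<in> {1..horizon G}" "x \<in> space (sab G)"
  shows "prob_space (f h x)" "sets (f h x) = sets (states G)" "space (f h x) = space (states G)"
proof -
  have "f h \<in> sab G \<rightarrow>\<^sub>M prob_algebra (states G)"
    using linear_mg_facts(2) assms by (auto simp: models_def)
  from prob_algebra_kernelD[OF this assms(3)]
  show "prob_space (f h x)" "sets (f h x) = sets (states G)" "space (f h x) = space (states G)" .
qed

lemma hellinger_loss_facts:
  assumes f: "f \<in> F" and h: "h \<in> {1..horizon G}"
  shows "hellinger_loss fs f h \<in> borel_measurable (sab G)"
    and "x \<in> space (sab G) \<Longrightarrow> 0 \<le> hellinger_loss fs f h x"
    and "x \<in> space (sab G) \<Longrightarrow> hellinger_loss fs f h x \<le> 1"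
    and "\<lbrakk>x \<in> space (sab G); U \<in> borel_measurable (states G);
        \<And>s. s \<in> space (states G) \<Longrightarrow> 0 \<le> U s; \<And>s. s \<in> space (states G) \<Longrightarrow> U s \<le> B\<rbrakk> \<Longrightarrow>
      ((\<integral>s. U s \<partial>f h x) - (\<integral>s. U s \<partial>fs h x))\<^sup>2 \<le> 8 * B\<^sup>2 * hellinger_loss fs f h x"
proof -
  note fs = linear_mg_facts(3)
  interpret S: sigma_finite_measure "states G"
    using linear_mg_facts(1) by (simp add: fomg_def)
  obtain \<theta> where \<theta>: "\<theta> \<in> borel_measurable (states G)"
    "\<And>x. x \<in> space (sab G) \<Longrightarrow> f h x = density (states G) (\<lambda>s. ennreal (\<theta> s \<bullet> \<phi> x))"
    using linear_model_density[OF f h] by metis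
  obtain \<theta>' where \<theta>': "\<theta>' \<in> borel_measurable (states G)"
    "\<And>x. x \<in> space (sab G) \<Longrightarrow> fs h x = density (states G) (\<lambda>s. ennreal (\<theta>' s \<bullet> \<phi> x))"
    using linear_model_density[OF fs h] by metis
  note [measurable] = \<theta>(1) \<theta>'(1) linear_mg_facts(4)
  \<comment> \<open>The linear densities are nonnegative only almost everywhere. Truncation gives
    everywhere nonnegative ones and the same measures, since \<open>ennreal\<close> already sends
    negative reals to 0.\<close>
  define p where "p x s = max 0 (\<theta> s \<bullet> \<phi> x)" for x s
  define q where "q x s = max 0 (\<theta>' s \<bullet> \<phi> x)" for x s
  have ennreal_max: "ennreal (max 0 y) = ennreal y" for y
    by (simp add: max_def ennreal_neg)
  have d: "f h x = density (states G) (p x)" "fs h x = density (states G) (q x)"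
    if "x \<in> space (sab G)" for x
    using \<theta>(2)[OF that] \<theta>'(2)[OF that] by (simp_all add: p_def q_def ennreal_max)
  have m: "p x \<in> borel_measurable (states G)" "q x \<in> borel_measurable (states G)" for x
    unfolding p_def[abs_def] q_def[abs_def] by measurable
  have nn: "0 \<le> p x s" "0 \<le> q x s" for x s by (auto simp: p_def q_def)
  have ac: "ac_density (fs h x) (f h x) (\<lambda>s. ennreal (q x s / p x s))" if "x \<in> space (sab G)" for x
    unfolding d[OF that] by (rule ac_density_density[OF m nn])
  have sets: "sets (fs h x) = sets (f h x)" if "x \<in> space (sab G)" for x
    using linear_model_prob_space(2)[OF f h that] linear_model_prob_space(2)[OF fs h that] by simp
  note hb = hellinger_sq_bounds[OF linear_model_prob_space(1)[OF f h] linear_model_prob_space(1)[OF fs h] sets ac]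
  show "x \<in> space (sab G) \<Longrightarrow> 0 \<le> hellinger_loss fs f h x"
    and "x \<in> space (sab G) \<Longrightarrow> hellinger_loss fs f h x \<le> 1"
    unfolding hellinger_loss_def using hb[of x] by auto
  have eq: "hellinger_loss fs f h x = 1 / 2 * (\<integral>s. p x s * (sqrt (q x s / p x s) - 1)\<^sup>2 \<partial>states G)"
    if "x \<in> space (sab G)" for x
    unfolding hellinger_loss_def d[OF that]
    using linear_model_prob_space(1)[OF f h that, unfolded d[OF that]]
    by (intro hellinger_sq_density m nn) auto
  \<comment> \<open>The integrand is jointly measurable in \<open>x\<close> and \<open>s\<close>,
    and \<open>states G\<close> is sigma-finite, so the integral is measurable in
    \<open>x\<close>.\<close>
  have "(\<lambda>x. 1 / 2 * (\<integral>s. p x s * (sqrt (q x s / p x s) - 1)\<^sup>2 \<partial>states G)) \<in> borel_measurable (sab G)"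
    unfolding p_def q_def by measurable
  then show "hellinger_loss fs f h \<in> borel_measurable (sab G)"
    by (subst measurable_cong[OF eq])
  assume x: "x \<in> space (sab G)" and U: "U \<in> borel_measurable (states G)"
    "\<And>s. s \<in> space (states G) \<Longrightarrow> 0 \<le> U s" "\<And>s. s \<in> space (states G) \<Longrightarrow> U s \<le> B"
  note k = linear_model_prob_space[OF f h x]
  show "((\<integral>s. U s \<partial>f h x) - (\<integral>s. U s \<partial>fs h x))\<^sup>2 \<le> 8 * B\<^sup>2 * hellinger_loss fs f h x"
    unfolding hellinger_loss_def
    by (rule sq_integral_diff_le_hellinger_sq[OF k(1) linear_model_prob_space(1)[OF fs h x] sets[OF x] ac[OF x]])
      (use U in \<open>simp_all add: k(3) measurable_cong_sets[OF k(2) refl]\<close>)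
qed

text \<open>A single \<open>v\<close>, independent of \<open>x\<close>, serves every state-action
  triple: it ties the error met in the current round to the losses on data from earlier rounds. The
  factor 2 in its norm is the triangle inequality for the vectors of the two models.\<close>

lemma one_step_error_linear:
  fixes U :: "'s \<Rightarrow> real"
  assumes f: "f \<in> F" and h: "h \<in> {1..horizon G}" and B: "0 \<le> B"
    and U: "U \<in> borel_measurable (states G)"
      "\<And>s. s \<in> space (states G) \<Longrightarrow> 0 \<le> U s" "\<And>s. s \<in> space (states G) \<Longrightarrow> U s \<le> B"
  shows "\<exists>v. norm v \<le> 2 * B * sqrt CARD('d) \<and> (\<forall>x\<in>space (sab G).
    (\<integral>s. U s \<partial>f h x) - (\<integral>s. U s \<partial>fs h x) = v \<bullet> \<phi> x \<and>
    (v \<bullet> \<phi> x)\<^sup>2 \<le> 8 * B\<^sup>2 * hellinger_loss fs f h x)"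
proof -
  have abs: "\<And>s. s \<in> space (states G) \<Longrightarrow> \<bar>U s\<bar> \<le> B" using U by auto
  obtain v where v: "norm v \<le> B * sqrt CARD('d)"
    "\<And>x. x \<in> space (sab G) \<Longrightarrow> (\<integral>s. U s \<partial>f h x) = v \<bullet> \<phi> x"
    using linear_model_integral[OF f h U(1) abs B] by blast
  obtain v' where v': "norm v' \<le> B * sqrt CARD('d)"
    "\<And>x. x \<in> space (sab G) \<Longrightarrow> (\<integral>s. U s \<partial>fs h x) = v' \<bullet> \<phi> x"
    using linear_model_integral[OF linear_mg_facts(3) h U(1) abs B] by blast
  have gap: "(\<integral>s. U s \<partial>f h x) - (\<integral>s. U s \<partial>fs h x) = (v - v') \<bullet> \<phi> x" if "x \<in> space (sab G)" for x
    using v(2)[OF that] v'(2)[OF that] by (simp add: inner_diff_left)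
  show ?thesis
  proof (intro exI conjI ballI)
    show "norm (v - v') \<le> 2 * B * sqrt CARD('d)"
      using norm_triangle_ineq4[of v v'] v(1) v'(1) by simp
    fix x assume x: "x \<in> space (sab G)"
    show "(\<integral>s. U s \<partial>f h x) - (\<integral>s. U s \<partial>fs h x) = (v - v') \<bullet> \<phi> x" by (rule gap[OF x])
    show "((v - v') \<bullet> \<phi> x)\<^sup>2 \<le> 8 * B\<^sup>2 * hellinger_loss fs f h x"
      unfolding gap[OF x, symmetric] by (rule hellinger_loss_facts(4)[OF f h x U])
  qed
qed

text \<open>\<open>L\<close> stands for \<open>ln (1 + H * T / \<epsilon>)\<close>, so the size of
  \<open>T\<close> enters only through the log-determinant bound. That bound is guarded by a
  positive horizon: at horizon 0 the intended \<open>L\<close> is 0 and the bound fails once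
  \<open>T \<ge> 1\<close>, while there is no step to estimate.\<close>

lemma value_error_le_gec_rhs:
  fixes T :: nat and L :: real
  assumes L: "0 \<le> L" "horizon G > 0 \<Longrightarrow>
      ln (fact CARD('d) * (1 + real T * real CARD('d)) ^ CARD('d)) \<le> 2 * real CARD('d) * L"
    and eps: "0 \<le> \<epsilon>"
    and seq: "\<And>t. t \<in> {1..T} \<Longrightarrow> f t \<in> F \<and> \<pi> t \<in> policiesA G \<and> \<nu> t \<in> policiesB G"
  shows "\<bar>\<Sum>t=1..T. val G (f t) (\<pi> t) (\<nu> t) - val G fs (\<pi> t) (\<nu> t)\<bar>
    \<le> gec_rhs G fs (hellinger_loss fs) \<epsilon> T f \<pi> \<nu> (16 * real (horizon G) ^ 3 * real CARD('d) * L)"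
proof -
  let ?H = "horizon G" and ?d = "real CARD('d)"
  let ?V = "\<lambda>t h. playing.value_to_go G (\<pi> t) (\<nu> t) (f t) (?H - h)"
  have play: "playing G (\<pi> t) (\<nu> t)" if "t \<in> {1..T}" for t
    using seq[OF that] linear_mg_facts(1) by (simp add: playing_def)
  have fm: "f t \<in> models G" "f t \<in> F" if "t \<in> {1..T}" for t
    using seq[OF that] linear_mg_facts(2) by auto
  have fsm: "fs \<in> models G" using linear_mg_facts(2,3) by auto
  \<comment> \<open>The vector for \<open>(h, t)\<close> is fixed by the model and policies of round
    \<open>t\<close>; below it is paired with the mean features of all rounds up to
    \<open>t\<close>.\<close>
  have "\<forall>h t. \<exists>v. h \<in> {1..?H} \<and> t \<in> {1..T} \<longrightarrow> norm v \<le> 2 * real ?H * sqrt CARD('d) \<and>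
    (\<forall>x\<in>space (sab G). (\<integral>s. ?V t h s \<partial>f t h x) - (\<integral>s. ?V t h s \<partial>fs h x) = v \<bullet> \<phi> x \<and>
      (v \<bullet> \<phi> x)\<^sup>2 \<le> 8 * (real ?H)\<^sup>2 * hellinger_loss fs (f t) h x)" (is "\<forall>h t. \<exists>v. ?P h t v")
  proof (intro allI)
    fix h t
    show "\<exists>v. ?P h t v"
    proof (cases "h \<in> {1..?H} \<and> t \<in> {1..T}")
      case True
      then have h: "h \<in> {1..?H}" and t: "t \<in> {1..T}" by auto
      interpret playing G "\<pi> t" "\<nu> t" by (rule play[OF t])
      have V: "?V t h \<in> borel_measurable (states G) \<and> (\<forall>s\<in>space (states G). 0 \<le> ?V t h s \<and> ?V t h s \<le> real (?H - h))"
        by (rule value_to_go_facts[OF fm(1)[OF t]]) simp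
      have "?V t h s \<le> real ?H" if "s \<in> space (states G)" for s
        using V that by fastforce
      then show ?thesis
        using one_step_error_linear[OF fm(2)[OF t] h, of "real ?H" "?V t h"] V by auto
    qed auto
  qed
  then obtain v where v: "\<And>h t. ?P h t (v h t)" by metis
  define \<mu> where "\<mu> h t = (\<integral>\<omega>. \<phi> (\<omega> h) \<partial>traj G fs (\<pi> t) (\<nu> t) h)" for h t
  define e where "e h t \<tau> = data_expectation G fs (\<pi> \<tau>) (\<nu> \<tau>) h (hellinger_loss fs (f t) h)" for h t \<tau>
  have \<mu>: "norm (\<mu> h \<tau>) \<le> 1" "(\<integral>\<omega>. w \<bullet> \<phi> (\<omega> h) \<partial>traj G fs (\<pi> \<tau>) (\<nu> \<tau>) h) = w \<bullet> \<mu> h \<tau>"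
      "0 \<le> e h t \<tau>" "e h t \<tau> \<le> 1" "(v h t \<bullet> \<mu> h \<tau>)\<^sup>2 \<le> 8 * (real ?H)\<^sup>2 * e h t \<tau>"
    if h: "h \<in> {1..?H}" and t: "t \<in> {1..T}" and \<tau>: "\<tau> \<in> {1..T}" for h t \<tau> w
  proof -
    interpret playing G "\<pi> \<tau>" "\<nu> \<tau>" by (rule play[OF \<tau>])
    note S = sq_expectation_feature_le[OF fsm h linear_mg_facts(4,5) hellinger_loss_facts(1,2,3)[OF fm(2)[OF t] h]]
    show "norm (\<mu> h \<tau>) \<le> 1" unfolding \<mu>_def by (rule S(1))
    show "(\<integral>\<omega>. w \<bullet> \<phi> (\<omega> h) \<partial>traj G fs (\<pi> \<tau>) (\<nu> \<tau>) h) = w \<bullet> \<mu> h \<tau>" unfolding \<mu>_def by (rule S(2))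
    show "0 \<le> e h t \<tau>" unfolding e_def by (rule S(3))
    show "e h t \<tau> \<le> 1" unfolding e_def by (rule S(4))
    show "(v h t \<bullet> \<mu> h \<tau>)\<^sup>2 \<le> 8 * (real ?H)\<^sup>2 * e h t \<tau>"
      unfolding \<mu>_def e_def by (rule S(5)) (use v[of h t] h t in auto)
  qed
  have diff: "val G (f t) (\<pi> t) (\<nu> t) - val G fs (\<pi> t) (\<nu> t) = (\<Sum>h=1..?H. v h t \<bullet> \<mu> h t)"
    if t: "t \<in> {1..T}" for t
  proof -
    interpret playing G "\<pi> t" "\<nu> t" by (rule play[OF t])
    show ?thesis
      unfolding value_difference[OF fsm fm(1)[OF t]]
    proof (rule sum.cong[OF refl])
      fix h assume h: "h \<in> {1..?H}"
      have "(\<integral>\<omega>. (\<integral>s. ?V t h s \<partial>f t h (\<omega> h)) - (\<integral>s. ?V t h s \<partial>fs h (\<omega> h)) \<partial>traj G fs (\<pi> t) (\<nu> t) h) =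
        (\<integral>\<omega>. v h t \<bullet> \<phi> (\<omega> h) \<partial>traj G fs (\<pi> t) (\<nu> t) h)"
      proof (rule Bochner_Integration.integral_cong[OF refl])
        fix \<omega> assume "\<omega> \<in> space (traj G fs (\<pi> t) (\<nu> t) h)"
        then have "\<omega> h \<in> space (sab G)"
          using traj_facts(3)[OF fsm, of h] h by (auto simp: space_PiM)
        then show "(\<integral>s. ?V t h s \<partial>f t h (\<omega> h)) - (\<integral>s. ?V t h s \<partial>fs h (\<omega> h)) = v h t \<bullet> \<phi> (\<omega> h)"
          using v[of h t] h t by blast
      qed
      also have "\<dots> = v h t \<bullet> \<mu> h t" by (rule \<mu>(2)[OF h t t])
      finally show "(\<integral>\<omega>. (\<integral>s. ?V t h s \<partial>f t h (\<omega> h)) - (\<integral>s. ?V t h s \<partial>fs h (\<omega> h)) \<partial>traj G fs (\<pi> t) (\<nu> t) h) =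
        v h t \<bullet> \<mu> h t" .
    qed
  qed
  define E where "E h = (\<Sum>t=1..T. \<Sum>\<tau>=1..<t. e h t \<tau>)" for h
  have E: "0 \<le> E h" if "h \<in> {1..?H}" for h
    unfolding E_def by (intro sum_nonneg \<mu>(3)[OF that]) auto
  \<comment> \<open>These are \<open>12 * 2\<close> and \<open>8 * 2\<close>: the constants of
    \<open>?N\<close> below times the 2 in the bound on the log-determinant.\<close>
  let ?a = "24 * (real ?H)\<^sup>2 * real T * ?d * L" and ?b = "16 * (real ?H)\<^sup>2 * ?d * L"
  have stage: "(\<Sum>t=1..T. \<bar>v h t \<bullet> \<mu> h t\<bar>) \<le> sqrt (?a + ?b * E h)" if h: "h \<in> {1..?H}" for h
  proof -
    let ?P = "ln (fact CARD('d) * (1 + real T * ?d) ^ CARD('d))"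
    let ?N = "\<Sum>t=1..T. 1 / ?d * (norm (v h t))\<^sup>2 + (\<Sum>\<tau>=1..t. (v h t \<bullet> \<mu> h \<tau>)\<^sup>2)"
    \<comment> \<open>The 12 is 4 from the regularisation, where \<open>1 / d\<close> cancels the
      \<open>d\<close> in the squared norm of \<open>v\<close>, plus 8 from the term
      \<open>\<tau> = t\<close>, whose expected loss is at most 1.\<close>
    have N: "?N \<le> (\<Sum>t=1..T. 12 * (real ?H)\<^sup>2 + 8 * (real ?H)\<^sup>2 * (\<Sum>\<tau>=1..<t. e h t \<tau>))"
    proof (rule sum_mono)
      fix t assume t: "t \<in> {1..T}"
      have "(norm (v h t))\<^sup>2 \<le> (2 * real ?H * sqrt CARD('d))\<^sup>2"
        using v[of h t] h t by (intro power_mono) auto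
      then have nv: "1 / ?d * (norm (v h t))\<^sup>2 \<le> 4 * (real ?H)\<^sup>2"
        by (simp add: field_simps)
      have "(\<Sum>\<tau>=1..t. (v h t \<bullet> \<mu> h \<tau>)\<^sup>2) \<le> (\<Sum>\<tau>=1..t. 8 * (real ?H)\<^sup>2 * e h t \<tau>)"
        using t by (intro sum_mono \<mu>(5)[OF h t]) auto
      also have "\<dots> = 8 * (real ?H)\<^sup>2 * (\<Sum>\<tau>=1..<t. e h t \<tau>) + 8 * (real ?H)\<^sup>2 * e h t t"
        using t by (simp add: sum_distrib_left[symmetric] distrib_left[symmetric] atLeastLessThanSuc_atLeastAtMost[symmetric])
      also have "8 * (real ?H)\<^sup>2 * e h t t \<le> 8 * (real ?H)\<^sup>2"
        using \<mu>(4)[OF h t t] by (intro mult_left_le) auto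
      finally show "1 / ?d * (norm (v h t))\<^sup>2 + (\<Sum>\<tau>=1..t. (v h t \<bullet> \<mu> h \<tau>)\<^sup>2) \<le>
        12 * (real ?H)\<^sup>2 + 8 * (real ?H)\<^sup>2 * (\<Sum>\<tau>=1..<t. e h t \<tau>)"
        using nv by simp
    qed
    also have "\<dots> = 12 * (real ?H)\<^sup>2 * real T + 8 * (real ?H)\<^sup>2 * E h"
      by (simp add: sum.distrib E_def sum_distrib_left)
    finally have N: "?N \<le> 12 * (real ?H)\<^sup>2 * real T + 8 * (real ?H)\<^sup>2 * E h" .
    have "0 \<le> ?P"
      by (intro ln_ge_zero) (metis fact_ge_1 le_add_same_cancel1 mult_ge1_I mult_nonneg_nonneg of_nat_0_le_iff one_le_power)
    have "(\<Sum>t=1..T. \<bar>v h t \<bullet> \<mu> h t\<bar>) \<le> sqrt ?N * sqrt ?P"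
      using elliptical_potential[of "1 / ?d" T "\<mu> h" "v h"] \<mu>(1)[OF h] by simp
    also have "\<dots> \<le> sqrt (12 * (real ?H)\<^sup>2 * real T + 8 * (real ?H)\<^sup>2 * E h) * sqrt (2 * ?d * L)"
      using N L h E[OF h] \<open>0 \<le> ?P\<close> by (intro mult_mono real_sqrt_le_mono) auto
    also have "\<dots> = sqrt (?a + ?b * E h)"
      by (simp add: real_sqrt_mult[symmetric] algebra_simps)
    finally show ?thesis .
  qed
  have "\<bar>\<Sum>t=1..T. val G (f t) (\<pi> t) (\<nu> t) - val G fs (\<pi> t) (\<nu> t)\<bar> = \<bar>\<Sum>t=1..T. \<Sum>h=1..?H. v h t \<bullet> \<mu> h t\<bar>"
    using diff by simp
  also have "\<dots> \<le> (\<Sum>t=1..T. \<Sum>h=1..?H. \<bar>v h t \<bullet> \<mu> h t\<bar>)"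
    by (intro order_trans[OF sum_abs] sum_mono sum_abs)
  also have "\<dots> = (\<Sum>h=1..?H. \<Sum>t=1..T. \<bar>v h t \<bullet> \<mu> h t\<bar>)"
    by (rule sum.swap)
  also have "\<dots> \<le> (\<Sum>h=1..?H. sqrt (?a + ?b * E h))"
    by (intro sum_mono stage)
  also have "\<dots> \<le> real ?H * sqrt ?a + sqrt (?b * real ?H * (\<Sum>h=1..?H. E h))"
    using L E by (intro sum_sqrt_add_le) auto
  also have "?b * real ?H * (\<Sum>h=1..?H. E h) = (16 * real ?H ^ 3 * ?d * L) * (\<Sum>h=1..?H. E h)"
    by (simp add: power2_eq_square power3_eq_cube)
  also have "real ?H * sqrt ?a \<le> 2 * real ?H * sqrt ((16 * real ?H ^ 3 * ?d * L) * real ?H * real T)"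
  proof -
    \<comment> \<open>After cancellation this compares \<open>24 * H^2\<close> with
      \<open>64 * H^4\<close>.\<close>
    have le: "?a \<le> 4 * ((16 * real ?H ^ 3 * ?d * L) * real ?H * real T)"
    proof -
      have "(real ?H)\<^sup>2 \<le> real ?H ^ 4"
        by (cases "?H = 0") (auto intro!: power_increasing)
      then have "(24 * (real T * ?d * L)) * (real ?H)\<^sup>2 \<le> (64 * (real T * ?d * L)) * real ?H ^ 4"
        using L by (intro mult_mono) auto
      then show ?thesis by (simp add: power4_eq_xxxx power3_eq_cube mult_ac)
    qed
    have "sqrt ?a \<le> 2 * sqrt ((16 * real ?H ^ 3 * ?d * L) * real ?H * real T)"
      using real_sqrt_le_mono[OF le] by (simp only: real_sqrt_mult[of 4] real_sqrt_four)
    from mult_left_mono[OF this, of "real ?H"] show ?thesis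
      by (simp only: mult_ac of_nat_0_le_iff simp_thms)
  qed
  also have "2 * real ?H * sqrt ((16 * real ?H ^ 3 * ?d * L) * real ?H * real T) +
      sqrt ((16 * real ?H ^ 3 * ?d * L) * (\<Sum>h=1..?H. E h)) \<le>
    gec_rhs G fs (hellinger_loss fs) \<epsilon> T f \<pi> \<nu> (16 * real ?H ^ 3 * ?d * L)"
    using eps by (simp add: gec_rhs_def E_def e_def)
  finally show ?thesis by simp
qed

end

text \<open>Replacing \<open>fact d\<close> by \<open>(fact d) ^ d\<close> makes both arguments of
  \<open>ln\<close> into \<open>d\<close>-th powers. It remains to compare their bases, which are
  linear and quadratic in \<open>T\<close>.\<close>

lemma log_det_bound_eventually:
  fixes H d :: nat and \<epsilon> :: real
  assumes "0 < \<epsilon>" "0 < H" "0 < d"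
  shows "\<exists>T0. \<forall>T\<ge>T0. ln (fact d * (1 + real T * real d) ^ d) \<le> 2 * real d * ln (1 + real H * real T / \<epsilon>)"
proof (intro exI allI impI)
  \<comment> \<open>Solves \<open>fact d * (1 + d) * T \<le> (H * T / \<epsilon>)^2\<close> for
    \<open>T\<close>. The \<open>+ 1\<close> in the threshold ensures \<open>T \<ge> 1\<close>,
    which gives \<open>1 + T * d \<le> (1 + d) * T\<close>.\<close>
  let ?c = "fact d * (1 + real d) / (real H / \<epsilon>)\<^sup>2"
  fix T assume T: "nat \<lceil>?c\<rceil> + 1 \<le> T"
  have T1: "1 \<le> real T" using T by simp
  have "?c \<le> real T" using T by linarith
  then have c: "fact d * (1 + real d) \<le> (real H / \<epsilon>)\<^sup>2 * real T"
    using assms by (simp add: field_simps)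
  have "fact d * (1 + real T * real d) ^ d \<le> (fact d) ^ d * (1 + real T * real d) ^ d"
    using assms by (intro mult_right_mono self_le_power) auto
  also have "\<dots> = (fact d * (1 + real T * real d)) ^ d" by (simp add: power_mult_distrib)
  also have "\<dots> \<le> ((1 + real H * real T / \<epsilon>)\<^sup>2) ^ d"
  proof (rule power_mono)
    have "fact d * (1 + real T * real d) \<le> fact d * ((1 + real d) * real T)"
      using T1 by (intro mult_left_mono) (auto simp: algebra_simps)
    also have "\<dots> \<le> (real H / \<epsilon>)\<^sup>2 * real T * real T"
      using mult_right_mono[OF c, of "real T"] by (simp add: mult_ac)
    also have "\<dots> = (real H * real T / \<epsilon>)\<^sup>2" by (simp add: power2_eq_square)
    also have "\<dots> \<le> (1 + real H * real T / \<epsilon>)\<^sup>2"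
      using assms by (intro power_mono) auto
    finally show "fact d * (1 + real T * real d) \<le> (1 + real H * real T / \<epsilon>)\<^sup>2" .
  qed simp
  finally have "ln (fact d * (1 + real T * real d) ^ d) \<le> ln (((1 + real H * real T / \<epsilon>)\<^sup>2) ^ d)"
    by (intro ln_mono) (auto simp: add_pos_nonneg)
  also have "\<dots> = 2 * real d * ln (1 + real H * real T / \<epsilon>)"
    using assms by (simp add: ln_realpow add_pos_nonneg)
  finally show "ln (fact d * (1 + real T * real d) ^ d) \<le> 2 * real d * ln (1 + real H * real T / \<epsilon>)" .
qed

text \<open>The threshold is chosen before the game, so it depends only on \<open>H\<close>,
  \<open>\<epsilon>\<close> and the dimension. Admissibility of \<open>D\<close> is asserted along
  with the bounds on the infima because the infimum of an empty set of reals is an unspecified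
  number.\<close>

theorem propositionB2:
  fixes H :: nat and \<epsilon> :: real
  assumes "\<epsilon> > 0"
  shows "\<exists>T0::nat. \<forall>T\<ge>T0.
    \<forall>(G :: ('s, 'a, 'b) game) (\<phi> :: 's \<times> 'a \<times> 'b \<Rightarrow> real ^ 'd) F fs.
      linear_mg G \<phi> F fs \<and> horizon G = H \<longrightarrow>
        (let D = 16 * real H ^ 3 * real CARD('d) * ln (1 + real H * real T / \<epsilon>);
             l = hellinger_loss fs
         in self_play_admissible G F fs l \<epsilon> T D \<and> self_play_gec G F fs l \<epsilon> T \<le> D \<and>
            adversarial_admissible G F fs l \<epsilon> T D \<and> adversarial_gec G F fs l \<epsilon> T \<le> D)"
proof -
  have "\<exists>T0. \<forall>T\<ge>T0. H > 0 \<longrightarrow> ln (fact CARD('d) * (1 + real T * real CARD('d)) ^ CARD('d))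
      \<le> 2 * real CARD('d) * ln (1 + real H * real T / \<epsilon>)"
    using log_det_bound_eventually[where \<epsilon> = \<epsilon> and H = H and d = "CARD('d)"] assms by (cases "H > 0") auto
  then obtain T0 where T0: "\<And>T. T \<ge> T0 \<Longrightarrow> H > 0 \<Longrightarrow>
      ln (fact CARD('d) * (1 + real T * real CARD('d)) ^ CARD('d))
      \<le> 2 * real CARD('d) * ln (1 + real H * real T / \<epsilon>)" by blast
  show ?thesis
  proof (intro exI allI impI)
    fix T and G :: "('s, 'a, 'b) game" and \<phi> :: "'s \<times> 'a \<times> 'b \<Rightarrow> real ^ 'd" and F fs
    assume T: "T0 \<le> T" and "linear_mg G \<phi> F fs \<and> horizon G = H"
    then have linear: "linear_mg G \<phi> F fs" and H: "horizon G = H" by auto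
    define L where "L = ln (1 + real H * real T / \<epsilon>)"
    define D where "D = 16 * real H ^ 3 * real CARD('d) * L"
    have L: "0 \<le> L" unfolding L_def using assms by (intro ln_ge_zero) auto
    have D: "0 \<le> D" unfolding D_def using L by simp
    have main: "\<bar>\<Sum>t=1..T. val G (f t) (\<pi> t) (\<nu> t) - val G fs (\<pi> t) (\<nu> t)\<bar>
        \<le> gec_rhs G fs (hellinger_loss fs) \<epsilon> T f \<pi> \<nu> D"
      if "\<And>t. t \<in> {1..T} \<Longrightarrow> f t \<in> F \<and> \<pi> t \<in> policiesA G \<and> \<nu> t \<in> policiesB G" for f \<pi> \<nu>
      using value_error_le_gec_rhs[OF linear L _ _ that, where \<epsilon> = \<epsilon>] T0[OF T] assms
      by (simp add: H D_def L_def)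
    have sp: "self_play_admissible G F fs (hellinger_loss fs) \<epsilon> T D"
      unfolding self_play_admissible_def
    proof (intro conjI D allI impI ballI)
      fix f g \<pi> \<nu> \<rho>
      assume a: "\<forall>t\<in>{1..T}. f t \<in> F \<and> g t \<in> F \<and> self_play_pair G (f t) (g t) (\<pi> t) (\<nu> t)"
        and \<rho>: "\<rho> \<in> {f, g}"
      show "\<bar>\<Sum>t=1..T. val G (\<rho> t) (\<pi> t) (\<nu> t) - val G fs (\<pi> t) (\<nu> t)\<bar>
          \<le> gec_rhs G fs (hellinger_loss fs) \<epsilon> T \<rho> \<pi> \<nu> D"
        \<comment> \<open>In either alternative of \<open>self_play_pair\<close>, the two optimality
          conditions place the policies in their policy sets.\<close>
        using a \<rho> by (intro main)
          (auto simp: self_play_pair_def maximin_def minimax_def is_arg_max_def is_arg_min_def)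
    qed
    have adv: "adversarial_admissible G F fs (hellinger_loss fs) \<epsilon> T D"
      unfolding adversarial_admissible_def
    proof (intro conjI D allI impI)
      fix f \<pi> \<nu>
      assume a: "\<forall>t\<in>{1..T}. f t \<in> F \<and> maximin G (f t) (\<pi> t) \<and> \<nu> t \<in> policiesB G"
      have "\<bar>\<Sum>t=1..T. val G (f t) (\<pi> t) (\<nu> t) - val G fs (\<pi> t) (\<nu> t)\<bar>
          \<le> gec_rhs G fs (hellinger_loss fs) \<epsilon> T f \<pi> \<nu> D"
        using a by (intro main) (auto simp: maximin_def is_arg_max_def)
      then show "(\<Sum>t=1..T. val G (f t) (\<pi> t) (\<nu> t) - val G fs (\<pi> t) (\<nu> t))
          \<le> gec_rhs G fs (hellinger_loss fs) \<epsilon> T f \<pi> \<nu> D" by linarith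
    qed
    \<comment> \<open>The clause \<open>0 \<le> D\<close> in admissibility provides the lower bound
      that \<open>cInf_lower\<close> asks for.\<close>
    have "self_play_gec G F fs (hellinger_loss fs) \<epsilon> T \<le> D"
      unfolding self_play_gec_def using sp
      by (intro cInf_lower) (auto simp: self_play_admissible_def bdd_below_def)
    moreover have "adversarial_gec G F fs (hellinger_loss fs) \<epsilon> T \<le> D"
      unfolding adversarial_gec_def using adv
      by (intro cInf_lower) (auto simp: adversarial_admissible_def bdd_below_def)
    ultimately show "let D = 16 * real H ^ 3 * real CARD('d) * ln (1 + real H * real T / \<epsilon>);
             l = hellinger_loss fs
         in self_play_admissible G F fs l \<epsilon> T D \<and> self_play_gec G F fs l \<epsilon> T \<le> D \<and>
            adversarial_admissible G F fs l \<epsilon> T D \<and> adversarial_gec G F fs l \<epsilon> T \<le> D"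
      unfolding Let_def L_def[symmetric] D_def[symmetric] using sp adv by blast
  qed
qed

end
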